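(* Let $G_3(\alpha,\beta)=(\alpha^2+\beta^2+6\alpha\beta)^2-16\alpha\beta\left(4(1+\alpha\beta)-3(\alpha+\beta)\right)^2$. Then for all $p\in\mathbb{C}$ with $0<|p|$ sufficiently small, \[\mathrm{m}\!\left(G_3\!\left(\frac{(x+x^{-1})^2(y+y^{-1})^2}{16},\ \frac1p\left(\frac{1+2p}{2+p}\right)^3\right)\right)=-16\log 2-16\,\mu\!\left(p\left(\frac{2+p}{1+2p}\right)^3\right)+8\,\mu\!\left(p^3\,\frac{2+p}{1+2p}\right).\]
   Context: $\mathrm{m}(P)=\int_0^1\int_0^1\log|P(e^{2\pi i\theta_1},e^{2\pi i\theta_2})|d\theta_1d\theta_2$ is the logarithmic Mahler measure of a Laurent polynomial in $x,y$; $\mu(t)=\mathrm{m}\!\left(\frac{4}{\sqrt t}+x+\frac1x+y+\frac1y\right)$. *)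

theory Defs
  imports "HOL-Analysis.Analysis"
begin

definition mahler2 :: "(complex \<Rightarrow> complex \<Rightarrow> complex) \<Rightarrow> real" where
  "mahler2 P = (LINT t : ({0..1} \<times> {0..1}) | lborel.
      ln (cmod (P (cis (2 * pi * fst t)) (cis (2 * pi * snd t)))))"

text \<open>mu(t) = m(4/sqrt t + x + 1/x + y + 1/y), principal square root
(the choice of branch does not affect the value).\<close>
definition mu :: "complex \<Rightarrow> real" where
  "mu t = mahler2 (\<lambda>x y. 4 / csqrt t + x + inverse x + y + inverse y)"

definition G3 :: "complex \<Rightarrow> complex \<Rightarrow> complex" where
  "G3 a b = (a^2 + b^2 + 6*a*b)^2 - 16*a*b*(4*(1 + a*b) - 3*(a + b))^2"

end

theory Submission
  imports Defs "HOL-Complex_Analysis.Complex_Analysis"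
begin

text \<open>
  Put \<open>t = p ((2 + p) / (1 + 2p))^3\<close> and \<open>v = p^3 (2 + p) / (1 + 2p)\<close>, and let
  \<open>H(z)\<close> be the mean of \<open>Log (1 - z a)\<close> over the torus, where
  \<open>a = (x + 1/x)^2 (y + 1/y)^2 / 16\<close>. Since \<open>a\<close> and \<open>((x + 1/x + y + 1/y) / 4)^2\<close> have the
  same moments, \<open>mu(t) = log 4 - log |t| / 2 + Re H(t) / 2\<close>. The reciprocal symmetry of \<open>G3\<close> gives
  \<open>G3(a, 1/t) = t^(-4) (1 - a v) \<Prod>\<^sub>j (1 - a u\<^sub>j)\<close>, where \<open>v, u\<^sub>1, u\<^sub>2, u\<^sub>3\<close> are the roots of
  \<open>G3(\<cdot>, t)\<close>, so the claim becomes a relation of Hecke type between \<open>\<Sum>\<^sub>j H(u\<^sub>j)\<close>,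
  \<open>H(v)\<close> and \<open>H(t)\<close>. Its derivative involves only \<open>f = 2F1(1/2, 1/2; 1; -)\<close>, because
  \<open>z H'(z) = 1 - f(z)\<close>. Writing \<open>c^3 = 4p (1 + p)\<close>, Ramanujan's cubic transformation, applied twice,
  gives \<open>f(u\<^sub>j) = (1 + \<omega>^j c)^2 f(v)\<close>. These multipliers show that the four roots are distinct, and
  they reduce the derivative of the Hecke relation to sums of polynomials over the cube roots of unity.
\<close>

subsection \<open>Means over the circle and the torus\<close>

definition circle_mean :: "(complex \<Rightarrow> 'a) \<Rightarrow> 'a :: {banach, second_countable_topology}" where
  "circle_mean f = (LINT x:{0..1}|lborel. f (cis (2 * pi * x)))"

definition torus_mean :: "(complex \<Rightarrow> complex \<Rightarrow> 'a) \<Rightarrow> 'a :: {banach, second_countable_topology}" where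
  "torus_mean f = (LINT t:{0..1} \<times> {0..1}|lborel. f (cis (2 * pi * fst t)) (cis (2 * pi * snd t)))"

abbreviation continuous_on_torus :: "(complex \<Rightarrow> complex \<Rightarrow> 'a :: topological_space) \<Rightarrow> bool" where
  "continuous_on_torus f \<equiv> continuous_on (sphere 0 1 \<times> sphere 0 1) (\<lambda>z. f (fst z) (snd z))"

lemma mahler2_eq_torus_mean: "mahler2 P = torus_mean (\<lambda>x y. ln (cmod (P x y)))"
  by (simp add: mahler2_def torus_mean_def)

lemma set_integrable_compact:
  fixes f :: "'a :: euclidean_space \<Rightarrow> 'b :: {banach, second_countable_topology}"
  assumes "compact K" "continuous_on K f"
  shows "set_integrable lborel K f"
  using assms by (simp add: set_integrable_def borel_integrable_compact)

lemma continuous_on_torus_param: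
  assumes "continuous_on_torus f"
  shows "continuous_on ({0..1} \<times> {0..1}) (\<lambda>t. f (cis (2 * pi * fst t)) (cis (2 * pi * snd t)))"
proof -
  have "continuous_on ({0..1} \<times> {0..1})
      (\<lambda>t :: real \<times> real. (cis (2 * pi * fst t), cis (2 * pi * snd t)))"
    by (intro continuous_intros)
  from continuous_on_compose2[OF assms this] show ?thesis by force
qed

lemma set_integrable_torus:
  fixes f :: "complex \<Rightarrow> complex \<Rightarrow> 'a :: {banach, second_countable_topology}"
  assumes "continuous_on_torus f"
  shows "set_integrable lborel ({0..1} \<times> {0..1}) (\<lambda>t. f (cis (2 * pi * fst t)) (cis (2 * pi * snd t)))"
  by (intro set_integrable_compact compact_Times compact_Icc continuous_on_torus_param assms)

lemma torus_mean_cong: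
  assumes "\<And>x y. cmod x = 1 \<Longrightarrow> cmod y = 1 \<Longrightarrow> f x y = g x y"
  shows "torus_mean f = torus_mean g"
  using assms by (simp add: torus_mean_def)

lemma torus_mean_add:
  assumes "continuous_on_torus f" "continuous_on_torus g"
  shows "torus_mean (\<lambda>x y. f x y + g x y) = torus_mean f + torus_mean g"
  using assms[THEN set_integrable_torus] by (simp add: torus_mean_def)

lemma torus_mean_cmult:
  fixes c :: "'a :: {banach, real_normed_field, second_countable_topology}"
  shows "torus_mean (\<lambda>x y. c * f x y) = c * torus_mean f"
  by (simp add: torus_mean_def)

lemma torus_mean_sum:
  assumes "\<And>k. k \<in> A \<Longrightarrow> continuous_on_torus (f k)"
  shows "torus_mean (\<lambda>x y. \<Sum>k\<in>A. f k x y) = (\<Sum>k\<in>A. torus_mean (f k))"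
  unfolding torus_mean_def set_lebesgue_integral_def scaleR_sum_right
  by (intro Bochner_Integration.integral_sum set_integrable_torus[OF assms, unfolded set_integrable_def])

lemma Re_torus_mean:
  assumes "continuous_on_torus f"
  shows "Re (torus_mean f) = torus_mean (\<lambda>x y. Re (f x y))"
  using integral_Re[OF set_integrable_torus[OF assms, unfolded set_integrable_def]]
  by (simp add: torus_mean_def set_lebesgue_integral_def)

lemma torus_mean_mult:
  fixes f g :: "complex \<Rightarrow> 'a :: {banach, real_normed_field, second_countable_topology}"
  assumes "continuous_on (sphere 0 1) f" "continuous_on (sphere 0 1) g"
  shows "torus_mean (\<lambda>x y. f x * g y) = circle_mean f * circle_mean g"
proof -
  define F where "F = (\<lambda>x y. (indicator {0..1} x *\<^sub>R f (cis (2 * pi * x))) *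
      (indicator {0..1} y *\<^sub>R g (cis (2 * pi * y))))"
  have F: "indicator ({0..1} \<times> {0..1}) t *\<^sub>R (f (cis (2 * pi * fst t)) * g (cis (2 * pi * snd t))) =
      case_prod F t" for t
    by (auto simp: F_def indicator_times split: prod.split split_indicator)
  have "continuous_on_torus (\<lambda>x y. f x * g y)"
    by (intro continuous_intros continuous_on_compose2[OF assms(1)]
        continuous_on_compose2[OF assms(2)]) auto
  from set_integrable_torus[OF this]
  have integrable: "integrable (lborel \<Otimes>\<^sub>M lborel) (case_prod F)"
    unfolding set_integrable_def F lborel_prod by simp
  have "torus_mean (\<lambda>x y. f x * g y) = integral\<^sup>L (lborel \<Otimes>\<^sub>M lborel) (case_prod F)"
    unfolding torus_mean_def set_lebesgue_integral_def F lborel_prod by simp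
  also have "\<dots> = (\<integral>x. (\<integral>y. F x y \<partial>lborel) \<partial>lborel)"
    by (rule lborel_pair.integral_fst[OF integrable, symmetric])
  also have "\<dots> = circle_mean f * circle_mean g"
    by (simp only: F_def circle_mean_def set_lebesgue_integral_def
        integral_mult_right_zero integral_mult_left_zero)
  finally show ?thesis .
qed

lemma torus_mean_const:
  fixes c :: "'a :: {banach, second_countable_topology}"
  shows "torus_mean (\<lambda>x y. c) = c"
proof -
  have "emeasure (lborel :: (real \<times> real) measure) ({0..1} \<times> {0..1}) = 1"
    unfolding lborel_prod[symmetric] by (subst lborel.emeasure_pair_measure_Times) auto
  moreover have "({0..1} \<times> {0..1} :: (real \<times> real) set) \<in> sets lborel"
    by (simp add: borel_closed closed_Times)
  ultimately show ?thesis
    by (simp add: torus_mean_def set_integral_const measure_def)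
qed

lemma sums_set_integral_power_series:
  fixes a :: "nat \<Rightarrow> 'b :: {banach, real_normed_field, second_countable_topology}"
    and f :: "'a :: euclidean_space \<Rightarrow> 'b"
  assumes compact: "compact K" and continuous: "continuous_on K f"
    and bound: "\<And>t. t \<in> K \<Longrightarrow> norm (f t) \<le> r"
    and summable: "summable (\<lambda>n. norm (a n) * r ^ n)"
  shows "(\<lambda>n. a n * (LINT t:K|lborel. f t ^ n)) sums (LINT t:K|lborel. (\<Sum>n. a n * f t ^ n))"
proof (cases "K = {}")
  case False
  then have r_nonneg: "0 \<le> r" using bound norm_ge_zero order_trans by blast
  define F where "F = (\<lambda>n t. indicator K t *\<^sub>R (a n * f t ^ n))"
  have norm_F: "norm (F n t) \<le> indicator K t *\<^sub>R (norm (a n) * r ^ n)" for n t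
    using bound[of t]
    by (auto simp: F_def norm_mult norm_power intro!: mult_left_mono power_mono split: split_indicator)
  have integrable_F: "integrable lborel (F n)" for n
    unfolding F_def by (intro borel_integrable_compact compact continuous_intros continuous)
  have "(\<lambda>n. integral\<^sup>L lborel (F n)) sums (\<integral>t. (\<Sum>n. F n t) \<partial>lborel)"
  proof (rule sums_integral[OF integrable_F])
    have "norm (F n t) \<le> norm (a n) * r ^ n" for n t
      using norm_F[of n t] r_nonneg by (cases "t \<in> K") (auto simp: F_def)
    then show "AE t in lborel. summable (\<lambda>n. norm (F n t))"
      by (intro AE_I2 summable_comparison_test'[OF summable, of 0]) auto
    have "(\<integral>t. norm (F n t) \<partial>lborel) \<le> measure lborel K * (norm (a n) * r ^ n)" for n
    proof -
      have "(\<integral>t. norm (F n t) \<partial>lborel) \<le> (LINT t:K|lborel. norm (a n) * r ^ n)"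
        unfolding set_lebesgue_integral_def
        by (intro integral_mono norm_F integrable_norm integrable_F
            borel_integrable_compact compact continuous_intros)
      then show ?thesis
        using compact emeasure_compact_finite[OF compact]
        by (simp add: set_integral_const borel_compact mult_ac)
    qed
    then show "summable (\<lambda>n. \<integral>t. norm (F n t) \<partial>lborel)"
      by (intro summable_comparison_test'[OF summable_mult[OF summable], of 0]) auto
  qed
  moreover have "integral\<^sup>L lborel (F n) = a n * (LINT t:K|lborel. f t ^ n)" for n
    by (simp add: F_def set_lebesgue_integral_def flip: mult_scaleR_right)
  moreover have "(\<Sum>n. F n t) = indicator K t *\<^sub>R (\<Sum>n. a n * f t ^ n)" for t
    by (cases "t \<in> K") (auto simp: F_def)
  ultimately show ?thesis by (simp add: set_lebesgue_integral_def)
qed (simp add: set_lebesgue_integral_def)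

lemma circle_mean_power_int: "circle_mean (\<lambda>x. x powi k) = of_bool (k = 0)"
proof (cases "k = 0")
  case True
  then show ?thesis by (simp add: circle_mean_def set_integral_const)
next
  case False
  let ?F = "\<lambda>x. cis (2 * pi * of_int k * x) / (2 * pi * of_int k * \<i>)"
  have "(\<integral>x. indicator {0..1} x *\<^sub>R cis (2 * pi * of_int k * x) \<partial>lborel) = ?F 1 - ?F 0"
  proof (rule integral_FTC_atLeastAtMost)
    show "(?F has_vector_derivative cis (2 * pi * of_int k * x)) (at x within {0..1})" for x
      using False unfolding has_vector_derivative_def
      by (auto intro!: derivative_eq_intros simp: scaleR_conv_of_real fun_eq_iff mult_ac)
  qed (auto intro!: continuous_intros)
  also have "\<dots> = 0"
    using cis_multiple_2pi[of "of_int k"] by simp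
  finally show ?thesis
    using False by (simp add: circle_mean_def set_lebesgue_integral_def cis_power_int mult_ac)
qed

definition central_coeff :: "nat \<Rightarrow> nat" where
  "central_coeff m = (if even m then m choose (m div 2) else 0)"

lemma circle_mean_add_inverse_power:
  "circle_mean (\<lambda>x. (x + inverse x) ^ m) = of_nat (central_coeff m)"
proof -
  have expand: "(x + inverse x) ^ m = (\<Sum>k\<le>m. of_nat (m choose k) * x powi (2 * int k - int m))"
    if "x \<noteq> 0" for x :: complex
  proof -
    have "x ^ k * inverse x ^ (m - k) = x powi (2 * int k - int m)" if "k \<le> m" for k
    proof -
      have "2 * int k - int m = int k - int (m - k)" using that by simp
      then have "x powi (2 * int k - int m) = x powi int k / x powi int (m - k)"
        using \<open>x \<noteq> 0\<close> by (simp only: power_int_diff simp_thms)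
      then show ?thesis by (simp add: divide_inverse power_inverse)
    qed
    then show ?thesis by (simp add: binomial_ring mult.assoc)
  qed
  have "circle_mean (\<lambda>x. (x + inverse x) ^ m) =
      circle_mean (\<lambda>x. \<Sum>k\<le>m. of_nat (m choose k) * x powi (2 * int k - int m))"
    unfolding circle_mean_def expand[OF cis_neq_zero] ..
  also have "\<dots> = (\<Sum>k\<le>m. of_nat (m choose k) * circle_mean (\<lambda>x. x powi (2 * int k - int m)))"
    unfolding circle_mean_def set_lebesgue_integral_def scaleR_sum_right
    by (subst Bochner_Integration.integral_sum)
       (auto intro!: borel_integrable_compact continuous_intros simp flip: mult_scaleR_right)
  also have "\<dots> = (\<Sum>k\<le>m. of_nat (m choose k) * of_bool (2 * k = m))"
    unfolding circle_mean_power_int by (intro sum.cong) auto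
  also have "\<dots> = of_nat (central_coeff m)"
  proof (cases "even m")
    case True
    then have "2 * k = m \<longleftrightarrow> k = m div 2" for k by auto
    then show ?thesis using True by (simp add: central_coeff_def of_bool_def if_distrib cong: if_cong)
  next
    case False
    then have "2 * k \<noteq> m" for k by auto
    then show ?thesis using False by (simp add: central_coeff_def)
  qed
  finally show ?thesis .
qed

lemma binomial_mult_central_coeff:
  assumes "j \<le> n"
  shows "((2 * n) choose (2 * j)) * central_coeff (2 * j) * central_coeff (2 * n - 2 * j) =
    ((2 * n) choose n) * (n choose j)\<^sup>2"
proof -
  have "real ((2 * n) choose (2 * j)) = fact (2 * n) / (fact (2 * j) * fact (2 * n - 2 * j))"
    "real (n choose j) = fact n / (fact j * fact (n - j))"
    using assms by (simp_all add: binomial_fact)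
  moreover have "real ((2 * m) choose m) = fact (2 * m) / (fact m * fact m)" for m
    by (simp add: binomial_fact)
  moreover have "2 * n - 2 * j = 2 * (n - j)" by simp
  ultimately have
    "real (((2 * n) choose (2 * j)) * central_coeff (2 * j) * central_coeff (2 * n - 2 * j)) =
      real (((2 * n) choose n) * (n choose j)\<^sup>2)"
    by (simp add: central_coeff_def power2_eq_square)
  then show ?thesis by (simp only: of_nat_eq_iff)
qed

lemma central_coeff_convolution:
  "(\<Sum>k\<le>m. (m choose k) * central_coeff k * central_coeff (m - k)) = (central_coeff m)\<^sup>2"
proof (cases "even m")
  case False
  then have "central_coeff k * central_coeff (m - k) = 0" if "k \<le> m" for k
    using that by (auto simp: central_coeff_def)
  then show ?thesis using False by (simp add: central_coeff_def mult.assoc)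
next
  case True
  then obtain n where m_eq: "m = 2 * n" by (elim evenE)
  let ?g = "\<lambda>k. (m choose k) * central_coeff k * central_coeff (m - k)"
  have "(\<Sum>k\<le>m. ?g k) = (\<Sum>k\<in>(\<lambda>j. 2 * j) ` {..n}. ?g k)"
  proof (rule sum.mono_neutral_right)
    show "\<forall>k\<in>{..m} - (\<lambda>j. 2 * j) ` {..n}. ?g k = 0"
    proof
      fix k assume k: "k \<in> {..m} - (\<lambda>j. 2 * j) ` {..n}"
      have "odd k"
        using k by (auto simp: m_eq elim!: evenE)
      then show "?g k = 0" by (simp add: central_coeff_def)
    qed
  qed (auto simp: m_eq)
  also have "\<dots> = (\<Sum>j\<le>n. ?g (2 * j))"
    by (subst sum.reindex) (auto simp: inj_on_def)
  also have "\<dots> = (\<Sum>j\<le>n. (m choose n) * (n choose j)\<^sup>2)"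
    using binomial_mult_central_coeff by (intro sum.cong) (simp_all add: m_eq)
  also have "\<dots> = (central_coeff m)\<^sup>2"
    by (simp add: m_eq choose_square_sum central_coeff_def power2_eq_square[of "_ choose n"]
        flip: sum_distrib_left)
  finally show ?thesis .
qed

lemma torus_mean_prod_power:
  "torus_mean (\<lambda>x y. ((x + inverse x) * (y + inverse y)) ^ m) = of_nat ((central_coeff m)\<^sup>2)"
  unfolding power_mult_distrib
  by (subst torus_mean_mult)
     (auto intro!: continuous_intros simp: circle_mean_add_inverse_power power2_eq_square)

lemma torus_mean_sum_power:
  "torus_mean (\<lambda>x y. (x + inverse x + (y + inverse y)) ^ m) = of_nat ((central_coeff m)\<^sup>2)"
proof -
  have "torus_mean (\<lambda>x y. (x + inverse x + (y + inverse y)) ^ m) =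
      torus_mean (\<lambda>x y. \<Sum>k\<le>m. of_nat (m choose k) * ((x + inverse x) ^ k * (y + inverse y) ^ (m - k)))"
    by (simp add: binomial_ring mult.assoc)
  also have "\<dots> = (\<Sum>k\<le>m. of_nat (m choose k) *
      torus_mean (\<lambda>x y. (x + inverse x) ^ k * (y + inverse y) ^ (m - k)))"
    by (subst torus_mean_sum) (auto intro!: continuous_intros simp: torus_mean_cmult)
  also have "\<dots> = (\<Sum>k\<le>m. of_nat (m choose k) *
      (of_nat (central_coeff k) * of_nat (central_coeff (m - k))))"
    by (subst torus_mean_mult) (auto intro!: continuous_intros simp: circle_mean_add_inverse_power)
  also have "\<dots> = of_nat (\<Sum>k\<le>m. (m choose k) * central_coeff k * central_coeff (m - k))"
    by (simp add: mult.assoc)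
  finally show ?thesis unfolding central_coeff_convolution .
qed

subsection \<open>The hypergeometric function 2F1(1/2, 1/2; 1; z)\<close>

definition hypergeo_half_fps :: "complex fps" where
  "hypergeo_half_fps = fps_hypergeo [1 / 2, 1 / 2] [1] 1"

definition hypergeo_half :: "complex \<Rightarrow> complex" where
  "hypergeo_half = eval_fps hypergeo_half_fps"

definition hypergeo_half_coeff :: "nat \<Rightarrow> real" where
  "hypergeo_half_coeff n = (pochhammer (1 / 2) n / fact n)\<^sup>2"

lemma fps_nth_hypergeo_half: "fps_nth hypergeo_half_fps n = of_real (hypergeo_half_coeff n)"
proof -
  have "pochhammer (1 / 2) n = complex_of_real (pochhammer (1 / 2) n)"
    by (simp flip: pochhammer_of_real)
  then show ?thesis
    by (simp add: hypergeo_half_fps_def hypergeo_half_coeff_def power_divide power2_eq_square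
        flip: pochhammer_fact)
qed

lemma hypergeo_half_coeff_0 [simp]: "hypergeo_half_coeff 0 = 1"
  by (simp add: hypergeo_half_coeff_def)

lemma hypergeo_half_coeff_nonneg: "0 \<le> hypergeo_half_coeff n"
  by (simp add: hypergeo_half_coeff_def)

lemma hypergeo_half_coeff_Suc:
  "(real n + 1)\<^sup>2 * hypergeo_half_coeff (Suc n) = (real n + 1 / 2)\<^sup>2 * hypergeo_half_coeff n"
  by (simp add: hypergeo_half_coeff_def pochhammer_Suc power_divide power_mult_distrib add.commute)

lemma hypergeo_half_coeff_eq_central_coeff:
  "hypergeo_half_coeff n = (real (central_coeff (2 * n)))\<^sup>2 / 16 ^ n"
proof -
  have "real (central_coeff (2 * n)) = fact (2 * n) / (fact n * fact n)"
    by (simp add: central_coeff_def binomial_fact)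
  also have "\<dots> = 4 ^ n * (pochhammer (1 / 2) n / fact n)"
    by (simp add: fact_double power_mult)
  finally have "(real (central_coeff (2 * n)))\<^sup>2 = (4 ^ n)\<^sup>2 * hypergeo_half_coeff n"
    by (simp only: hypergeo_half_coeff_def power_mult_distrib)
  also have "(4 ^ n)\<^sup>2 = (16 ^ n :: real)"
    by (simp add: power2_eq_square flip: power_mult_distrib)
  finally show ?thesis by simp
qed

lemma decseq_hypergeo_half_coeff: "decseq hypergeo_half_coeff"
proof (rule decseq_SucI)
  fix n
  have "(real n + 1)\<^sup>2 * hypergeo_half_coeff (Suc n) \<le> (real n + 1)\<^sup>2 * hypergeo_half_coeff n"
    unfolding hypergeo_half_coeff_Suc
    by (intro mult_right_mono power_mono hypergeo_half_coeff_nonneg) auto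
  then show "hypergeo_half_coeff (Suc n) \<le> hypergeo_half_coeff n"
    by simp
qed

lemma hypergeo_half_coeff_le_1: "hypergeo_half_coeff n \<le> 1"
  using decseqD[OF decseq_hypergeo_half_coeff, of 0 n] by simp

lemma fps_conv_radius_ge_1:
  fixes f :: "'a :: {banach, real_normed_field} fps"
  assumes "\<And>n. norm (fps_nth f n) \<le> 1"
  shows "fps_conv_radius f \<ge> 1"
  unfolding fps_conv_radius_def
proof (rule conv_radius_geI_ex)
  fix r :: real assume r_bounds: "0 < r" "ereal r < 1"
  have "summable (\<lambda>n. fps_nth f n * of_real r ^ n)"
  proof (rule summable_comparison_test'[of "\<lambda>n. r ^ n" 0])
    show "norm (fps_nth f n * of_real r ^ n) \<le> r ^ n" for n
      using assms[of n] r_bounds by (simp add: norm_mult norm_power mult_left_le_one_le)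
  qed (use r_bounds in \<open>simp add: summable_geometric\<close>)
  then show "\<exists>z. norm z = r \<and> summable (\<lambda>n. fps_nth f n * z ^ n)"
    using r_bounds by (intro exI[of _ "of_real r"]) auto
qed

lemma fps_conv_radius_hypergeo_half: "fps_conv_radius hypergeo_half_fps \<ge> 1"
  using hypergeo_half_coeff_nonneg hypergeo_half_coeff_le_1
  by (intro fps_conv_radius_ge_1) (simp add: fps_nth_hypergeo_half)

lemma norm_less_fps_conv_radius:
  assumes "norm z < 1" "fps_conv_radius f \<ge> 1"
  shows "ereal (norm z) < fps_conv_radius f"
  using assms by (metis ereal_less(3) less_ereal.simps(1) one_ereal_def order_less_le_trans)

lemma has_field_derivative_hypergeo_half:
  assumes "cmod z < 1"
  shows "(hypergeo_half has_field_derivative deriv hypergeo_half z) (at z)"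
  using has_field_derivative_eval_fps[OF norm_less_fps_conv_radius[OF assms fps_conv_radius_hypergeo_half]]
  unfolding hypergeo_half_def by (metis DERIV_imp_deriv)

lemma enestroem_kakeya_power_series:
  fixes a :: "nat \<Rightarrow> real" and z :: "'a :: {banach, real_normed_field}"
  assumes "decseq a" "\<And>n. 0 \<le> a n" "0 < a 0" and z_less_1: "norm z < 1"
  shows "(\<Sum>n. of_real (a n) * z ^ n) \<noteq> 0"
proof
  assume zero: "(\<Sum>n. of_real (a n) * z ^ n) = 0"
  obtain L where limit: "a \<longlonglongrightarrow> L" "0 \<le> L"
    using decseq_convergent[OF \<open>decseq a\<close>, of 0] assms(2) by (metis LIMSEQ_le_const)
  define d where "d = (\<lambda>n. a n - a (Suc n))"
  have d_sums: "d sums (a 0 - L)"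
    unfolding d_def by (rule telescope_sums'[OF limit(1)])
  have "summable (\<lambda>n. of_real (a n) * z ^ n)"
  proof (rule summable_comparison_test'[of "\<lambda>n. a 0 * norm z ^ n" 0])
    show "norm (of_real (a n) * z ^ n) \<le> a 0 * norm z ^ n" for n
      using assms(2)[of n] decseqD[OF \<open>decseq a\<close>, of 0 n]
      by (simp add: norm_mult norm_power mult_right_mono)
  qed (use z_less_1 in \<open>simp add: summable_geometric summable_mult\<close>)
  then have "(\<lambda>n. of_real (a n) * z ^ n) sums 0"
    using zero by (metis summable_sums)
  moreover from this have "(\<lambda>n. of_real (a (Suc n)) * z ^ Suc n) sums - of_real (a 0)"
    by (subst sums_Suc_iff) simp
  ultimately have "(\<lambda>n. z * (of_real (a n) * z ^ n) - of_real (a (Suc n)) * z ^ Suc n) sums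
      (z * 0 - - of_real (a 0))"
    by (intro sums_diff sums_mult)
  then have "(\<lambda>n. z * (of_real (d n) * z ^ n)) sums of_real (a 0)"
    by (simp add: d_def algebra_simps)
  moreover have "0 \<le> d n" for n
    using decseq_SucD[OF \<open>decseq a\<close>] by (simp add: d_def)
  then have "norm (z * (of_real (d n) * z ^ n)) \<le> norm z * d n" for n
    using z_less_1 by (simp add: norm_mult norm_power mult_left_mono mult_left_le power_le_one)
  ultimately have "a 0 \<le> norm z * (a 0 - L)"
    using norm_sums_le[OF _ sums_mult[OF d_sums]] assms(3) by fastforce
  also have "\<dots> \<le> norm z * a 0"
    using limit(2) by (intro mult_left_mono) auto
  also have "\<dots> < a 0"
    using z_less_1 assms(3) by simp
  finally show False by simp
qed

lemma hypergeo_half_nonzero: "cmod z < 1 \<Longrightarrow> hypergeo_half z \<noteq> 0"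
  unfolding hypergeo_half_def eval_fps_def fps_nth_hypergeo_half
  by (intro enestroem_kakeya_power_series decseq_hypergeo_half_coeff hypergeo_half_coeff_nonneg) auto

lemma hypergeo_half_0 [simp]: "hypergeo_half 0 = 1"
  by (simp add: hypergeo_half_def eval_fps_at_0 fps_nth_hypergeo_half)

lemma hypergeo_half_fps_ode:
  "fps_deriv (fps_X * (1 - fps_X) * fps_deriv hypergeo_half_fps) = fps_const (1 / 4) * hypergeo_half_fps"
proof (rule fps_ext)
  fix n
  define D where "D = fps_deriv hypergeo_half_fps"
  define E where "E = fps_X * (1 - fps_X) * D"
  have nth_D: "fps_nth D m = of_real ((real m + 1) * hypergeo_half_coeff (Suc m))" for m
    by (simp add: D_def fps_nth_hypergeo_half add.commute)
  have "fps_nth E (Suc n) = fps_nth D n - fps_nth (fps_X * D) n"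
    by (simp add: E_def mult.assoc left_diff_distrib)
  also have "\<dots> = of_real ((real n + 1) * hypergeo_half_coeff (Suc n) - real n * hypergeo_half_coeff n)"
    by (cases n) (simp_all add: nth_D add.commute)
  finally have "fps_nth (fps_deriv E) n =
      of_real ((real n + 1) * ((real n + 1) * hypergeo_half_coeff (Suc n) - real n * hypergeo_half_coeff n))"
    by (simp add: add.commute)
  also have "(real n + 1) * ((real n + 1) * hypergeo_half_coeff (Suc n) - real n * hypergeo_half_coeff n) =
      hypergeo_half_coeff n / 4"
    using hypergeo_half_coeff_Suc[of n] by (simp add: algebra_simps power2_eq_square)
  finally show "fps_nth (fps_deriv (fps_X * (1 - fps_X) * fps_deriv hypergeo_half_fps)) n =
      fps_nth (fps_const (1 / 4) * hypergeo_half_fps) n"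
    by (simp only: E_def D_def fps_nth_hypergeo_half fps_mult_left_const_nth) simp
qed

definition hypergeo_half_flux :: "complex \<Rightarrow> complex" where
  "hypergeo_half_flux z = z * (1 - z) * deriv hypergeo_half z"

lemma has_field_derivative_hypergeo_half_flux:
  assumes "cmod z < 1"
  shows "(hypergeo_half_flux has_field_derivative hypergeo_half z / 4) (at z)"
proof -
  define E where "E = fps_X * (1 - fps_X) * fps_deriv hypergeo_half_fps"
  have radius_X: "fps_conv_radius (1 - fps_X :: complex fps) = \<infinity>"
    using fps_conv_radius_diff[of "1 :: complex fps" fps_X] by simp
  have radius_XX: "fps_conv_radius (fps_X * (1 - fps_X) :: complex fps) = \<infinity>"
    using fps_conv_radius_mult[of "fps_X :: complex fps" "1 - fps_X"] radius_X by simp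
  have radius_D: "fps_conv_radius (fps_deriv hypergeo_half_fps) \<ge> 1"
    using fps_conv_radius_hypergeo_half fps_conv_radius_deriv order_trans by blast
  then have radius_E: "fps_conv_radius E \<ge> 1"
    using fps_conv_radius_mult[of "fps_X * (1 - fps_X)" "fps_deriv hypergeo_half_fps"] radius_XX
    by (auto simp: E_def intro: order_trans)
  have eval_E: "eval_fps E w = hypergeo_half_flux w" if "cmod w < 1" for w
    using radius_X radius_XX norm_less_fps_conv_radius[OF that radius_D]
      norm_less_fps_conv_radius[OF that fps_conv_radius_hypergeo_half]
    by (simp add: E_def eval_fps_mult eval_fps_diff eval_fps_deriv
        hypergeo_half_def hypergeo_half_flux_def)
  have "(eval_fps E has_field_derivative eval_fps (fps_deriv E) z) (at z)"
    by (intro has_field_derivative_eval_fps norm_less_fps_conv_radius assms radius_E)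
  also have "eval_fps (fps_deriv E) z = hypergeo_half z / 4"
    using norm_less_fps_conv_radius[OF assms fps_conv_radius_hypergeo_half]
    by (simp only: E_def hypergeo_half_fps_ode) (simp add: eval_fps_mult hypergeo_half_def)
  finally show ?thesis
    by (rule has_field_derivative_transform_within_open[of _ _ _ "ball 0 1"])
       (use assms in \<open>auto simp: eval_E\<close>)
qed

definition log_mean_fps :: "complex fps" where
  "log_mean_fps = Abs_fps (\<lambda>n. - of_real (hypergeo_half_coeff n) / of_nat n)"

definition log_mean :: "complex \<Rightarrow> complex" where
  "log_mean = eval_fps log_mean_fps"

lemma fps_conv_radius_log_mean: "fps_conv_radius log_mean_fps \<ge> 1"
proof (rule fps_conv_radius_ge_1)
  fix n show "cmod (fps_nth log_mean_fps n) \<le> 1"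
    using hypergeo_half_coeff_nonneg[of n] hypergeo_half_coeff_le_1[of n]
    by (cases "n = 0") (auto simp: log_mean_fps_def norm_divide divide_le_eq intro: order_trans)
qed

lemma log_mean_sums:
  assumes "cmod z < 1"
  shows "(\<lambda>n. - of_real (hypergeo_half_coeff n) * z ^ n / of_nat n) sums log_mean z"
  using sums_eval_fps[OF norm_less_fps_conv_radius[OF assms fps_conv_radius_log_mean]]
  by (simp add: log_mean_def log_mean_fps_def)

lemma log_mean_0 [simp]: "log_mean 0 = 0"
  by (simp add: log_mean_def eval_fps_at_0 log_mean_fps_def)

lemma has_field_derivative_log_mean:
  assumes "cmod z < 1"
  shows "(log_mean has_field_derivative deriv log_mean z) (at z)"
  using has_field_derivative_eval_fps[OF norm_less_fps_conv_radius[OF assms fps_conv_radius_log_mean]]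
  unfolding log_mean_def by (metis DERIV_imp_deriv)

lemma mult_deriv_log_mean:
  assumes "cmod z < 1"
  shows "z * deriv log_mean z = 1 - hypergeo_half z"
proof -
  note radius = norm_less_fps_conv_radius[OF assms]
  have "fps_X * fps_deriv log_mean_fps = 1 - hypergeo_half_fps"
  proof (rule fps_ext)
    show "fps_nth (fps_X * fps_deriv log_mean_fps) n = fps_nth (1 - hypergeo_half_fps) n" for n
      by (cases n) (simp_all add: log_mean_fps_def fps_nth_hypergeo_half del: of_nat_Suc)
  qed
  then have "eval_fps (fps_X * fps_deriv log_mean_fps) z = eval_fps (1 - hypergeo_half_fps) z"
    by simp
  then show ?thesis
    using radius[OF fps_conv_radius_hypergeo_half] radius[OF fps_conv_radius_log_mean]
      radius[OF order_trans[OF fps_conv_radius_log_mean fps_conv_radius_deriv]]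
    by (simp add: eval_fps_mult eval_fps_diff eval_fps_deriv log_mean_def hypergeo_half_def)
qed

subsection \<open>Mahler measures as values of the logarithmic primitive\<close>

definition torus_nonvanishing :: "(complex \<Rightarrow> complex \<Rightarrow> complex) \<Rightarrow> bool" where
  "torus_nonvanishing P \<longleftrightarrow>
    continuous_on_torus P \<and> (\<forall>x y. cmod x = 1 \<longrightarrow> cmod y = 1 \<longrightarrow> P x y \<noteq> 0)"

lemma torus_nonvanishing_mult:
  "torus_nonvanishing P \<Longrightarrow> torus_nonvanishing Q \<Longrightarrow> torus_nonvanishing (\<lambda>x y. P x y * Q x y)"
  by (auto simp: torus_nonvanishing_def intro!: continuous_intros)

lemma torus_nonvanishing_const: "c \<noteq> 0 \<Longrightarrow> torus_nonvanishing (\<lambda>x y. c)"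
  by (auto simp: torus_nonvanishing_def)

lemma mahler2_const: "mahler2 (\<lambda>x y. c) = ln (cmod c)"
  by (simp add: mahler2_eq_torus_mean torus_mean_const)

lemma mahler2_mult:
  assumes "torus_nonvanishing P" "torus_nonvanishing Q"
  shows "mahler2 (\<lambda>x y. P x y * Q x y) = mahler2 P + mahler2 Q"
proof -
  have "mahler2 (\<lambda>x y. P x y * Q x y) = torus_mean (\<lambda>x y. ln (cmod (P x y)) + ln (cmod (Q x y)))"
    unfolding mahler2_eq_torus_mean
    using assms by (intro torus_mean_cong) (simp add: torus_nonvanishing_def norm_mult ln_mult)
  also have "\<dots> = mahler2 P + mahler2 Q"
    unfolding mahler2_eq_torus_mean
    using assms by (intro torus_mean_add continuous_intros) (auto simp: torus_nonvanishing_def)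
  finally show ?thesis .
qed

lemma one_minus_not_nonpos_Reals:
  fixes w :: complex
  assumes "cmod w < 1"
  shows "1 - w \<notin> \<real>\<^sub>\<le>\<^sub>0"
  using assms abs_Re_le_cmod[of w] by (auto simp: complex_nonpos_Reals_iff)

locale torus_contraction =
  fixes X :: "complex \<Rightarrow> complex \<Rightarrow> complex"
  assumes continuous: "continuous_on_torus X"
    and norm_le_1: "\<And>x y. cmod x = 1 \<Longrightarrow> cmod y = 1 \<Longrightarrow> cmod (X x y) \<le> 1"
begin

lemma norm_mult_less_1:
  assumes "cmod z < 1" "cmod x = 1" "cmod y = 1"
  shows "cmod (z * X x y) < 1"
  using mult_left_le[OF norm_le_1[OF assms(2,3)], of "cmod z"] assms(1) by (simp add: norm_mult)

lemma torus_nonvanishing_one_minus: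
  assumes "cmod z < 1"
  shows "torus_nonvanishing (\<lambda>x y. 1 - z * X x y)"
  unfolding torus_nonvanishing_def
proof (intro conjI allI impI)
  show "continuous_on_torus (\<lambda>x y. 1 - z * X x y)"
    using continuous by (intro continuous_intros)
  show "1 - z * X x y \<noteq> 0" if "cmod x = 1" "cmod y = 1" for x y
    using norm_mult_less_1[OF assms that] by auto
qed

lemma Re_torus_mean_Ln_one_minus:
  assumes "cmod z < 1"
  shows "Re (torus_mean (\<lambda>x y. Ln (1 - z * X x y))) = mahler2 (\<lambda>x y. 1 - z * X x y)"
proof -
  note not_nonpos = one_minus_not_nonpos_Reals[OF norm_mult_less_1[OF assms]]
  have "continuous_on_torus (\<lambda>x y. Ln (1 - z * X x y))"
    using not_nonpos continuous by (auto intro!: continuous_intros)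
  moreover have "Re (Ln (1 - z * X x y)) = ln (cmod (1 - z * X x y))"
    if "cmod x = 1" "cmod y = 1" for x y
    using not_nonpos[OF that] by (intro Re_Ln) auto
  ultimately show ?thesis
    unfolding mahler2_eq_torus_mean by (subst Re_torus_mean) (auto intro!: torus_mean_cong)
qed

lemma mahler2_one_minus_sums:
  assumes z_less_1: "cmod z < 1"
  shows "(\<lambda>n. Re (- torus_mean (\<lambda>x y. X x y ^ n) * z ^ n / of_nat n)) sums
    mahler2 (\<lambda>x y. 1 - z * X x y)"
proof -
  define f where "f = (\<lambda>t. z * X (cis (2 * pi * fst t)) (cis (2 * pi * snd t)))"
  have norm_f: "cmod (f t) < 1" for t
    unfolding f_def using z_less_1 by (rule norm_mult_less_1) simp_all
  have Ln_f: "(\<Sum>n. - 1 / of_nat n * f t ^ n) = Ln (1 - f t)" for t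
    using Ln_series'[of "- f t"] norm_f[of t] by (simp add: sums_iff)
  have "summable (\<lambda>n. norm (- 1 / of_nat n :: complex) * cmod z ^ n)"
  proof (rule summable_comparison_test'[of "\<lambda>n. cmod z ^ n" 0])
    show "norm (norm (- 1 / of_nat n :: complex) * cmod z ^ n) \<le> cmod z ^ n" for n
    proof -
      have "norm (- 1 / of_nat n :: complex) \<le> 1"
        by (cases n) (auto simp: norm_divide simp del: of_nat_Suc)
      then show ?thesis by (simp add: norm_mult mult_left_le_one_le)
    qed
  qed (use z_less_1 in \<open>simp add: summable_geometric\<close>)
  moreover have "continuous_on ({0..1} \<times> {0..1}) f"
    unfolding f_def by (intro continuous_intros continuous_on_torus_param continuous)
  moreover have "cmod (f t) \<le> cmod z" for t
    unfolding f_def by (simp add: norm_mult mult_left_le norm_le_1)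
  ultimately have "(\<lambda>n. - 1 / of_nat n * (LINT t:{0..1} \<times> {0..1}|lborel. f t ^ n)) sums
      (LINT t:{0..1} \<times> {0..1}|lborel. Ln (1 - f t))"
    unfolding Ln_f[symmetric]
    by (intro sums_set_integral_power_series compact_Times compact_Icc)
  then have "(\<lambda>n. Re (- 1 / of_nat n * (z ^ n * torus_mean (\<lambda>x y. X x y ^ n)))) sums
      Re (torus_mean (\<lambda>x y. Ln (1 - z * X x y)))"
    by (intro sums_Re) (simp add: f_def torus_mean_def power_mult_distrib)
  then show ?thesis by (simp add: Re_torus_mean_Ln_one_minus[OF z_less_1] mult_ac)
qed

lemma mahler2_one_minus_eq_log_mean:
  assumes z_less_1: "cmod z < 1"
    and moments: "\<And>n. torus_mean (\<lambda>x y. X x y ^ n) = of_real (hypergeo_half_coeff n)"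
  shows "mahler2 (\<lambda>x y. 1 - z * X x y) = Re (log_mean z)"
  using sums_unique2[OF mahler2_one_minus_sums[OF z_less_1]
      sums_Re[OF log_mean_sums[OF z_less_1], folded moments]]
  by simp

lemma mahler2_one_minus_symmetric:
  assumes z_less_1: "cmod z < 1"
    and moments: "\<And>n. odd n \<Longrightarrow> torus_mean (\<lambda>x y. X x y ^ n) = 0"
  shows "mahler2 (\<lambda>x y. 1 + z * X x y) = mahler2 (\<lambda>x y. 1 - z * X x y)"
proof -
  have "- torus_mean (\<lambda>x y. X x y ^ n) * (- z) ^ n = - torus_mean (\<lambda>x y. X x y ^ n) * z ^ n" for n
    using moments by (cases "even n") auto
  then have "mahler2 (\<lambda>x y. 1 - - z * X x y) = mahler2 (\<lambda>x y. 1 - z * X x y)"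
    using sums_unique2[OF mahler2_one_minus_sums[of "- z"]] mahler2_one_minus_sums[OF z_less_1] z_less_1
    by (simp only: norm_minus_cancel)
  then show ?thesis by simp
qed

end

lemma norm_add_inverse_le_2: "cmod x = 1 \<Longrightarrow> cmod (x + inverse x) \<le> 2"
  using norm_triangle_ineq[of x "inverse x"] by (simp add: norm_inverse)

lemma torus_mean_prod_sq_power:
  "torus_mean (\<lambda>x y. ((x + inverse x)\<^sup>2 * (y + inverse y)\<^sup>2 / 16) ^ n) = of_real (hypergeo_half_coeff n)"
proof -
  have "((x + inverse x)\<^sup>2 * (y + inverse y)\<^sup>2 / 16) ^ n =
      1 / 16 ^ n * ((x + inverse x) * (y + inverse y)) ^ (2 * n)" for x y :: complex
    by (simp add: power_mult power_mult_distrib power_divide)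
  then show ?thesis
    by (simp only: torus_mean_cmult torus_mean_prod_power hypergeo_half_coeff_eq_central_coeff) simp
qed

lemma torus_contraction_prod_sq: "torus_contraction (\<lambda>x y. (x + inverse x)\<^sup>2 * (y + inverse y)\<^sup>2 / 16)"
proof
  show "continuous_on_torus (\<lambda>x y :: complex. (x + inverse x)\<^sup>2 * (y + inverse y)\<^sup>2 / 16)"
    by (intro continuous_intros) auto
  show "cmod ((x + inverse x)\<^sup>2 * (y + inverse y)\<^sup>2 / 16) \<le> 1" if "cmod x = 1" "cmod y = 1" for x y
    using mult_mono[OF power_mono[OF norm_add_inverse_le_2[OF that(1)], of 2]
        power_mono[OF norm_add_inverse_le_2[OF that(2)], of 2]]
    by (simp add: norm_mult norm_divide norm_power)
qed

lemma mahler2_one_minus_prod_sq: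
  assumes "cmod z < 1"
  shows "mahler2 (\<lambda>x y. 1 - z * ((x + inverse x)\<^sup>2 * (y + inverse y)\<^sup>2 / 16)) = Re (log_mean z)"
  using torus_contraction_prod_sq assms torus_mean_prod_sq_power
  by (rule torus_contraction.mahler2_one_minus_eq_log_mean)

lemma torus_mean_avg_power:
  "torus_mean (\<lambda>x y. ((x + inverse x + (y + inverse y)) / 4) ^ m) = of_nat ((central_coeff m)\<^sup>2) / 4 ^ m"
  using torus_mean_cmult[of "1 / 4 ^ m" "\<lambda>x y. (x + inverse x + (y + inverse y)) ^ m"]
  by (simp add: power_divide torus_mean_sum_power)

lemma torus_contraction_avg: "torus_contraction (\<lambda>x y. (x + inverse x + (y + inverse y)) / 4)"
proof
  show "continuous_on_torus (\<lambda>x y :: complex. (x + inverse x + (y + inverse y)) / 4)"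
    by (intro continuous_intros) auto
  show "cmod ((x + inverse x + (y + inverse y)) / 4) \<le> 1" if "cmod x = 1" "cmod y = 1" for x y
    using norm_triangle_ineq[of "x + inverse x" "y + inverse y"] that[THEN norm_add_inverse_le_2]
    by (simp add: norm_divide)
qed

lemma torus_contraction_power:
  "torus_contraction X \<Longrightarrow> torus_contraction (\<lambda>x y. X x y ^ n)"
  by (auto simp: torus_contraction_def norm_power intro!: continuous_intros power_le_one)

lemma mahler2_one_plus_avg:
  assumes w_less_1: "cmod w < 1"
  defines "X \<equiv> \<lambda>x y :: complex. (x + inverse x + (y + inverse y)) / 4"
  shows "mahler2 (\<lambda>x y. 1 + w * X x y) = Re (log_mean (w\<^sup>2)) / 2"
proof -
  interpret X: torus_contraction X unfolding X_def by (rule torus_contraction_avg)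
  have w2_less_1: "cmod (w\<^sup>2) < 1" using w_less_1 by (simp add: norm_power power_less_one_iff)
  have symmetric: "mahler2 (\<lambda>x y. 1 + w * X x y) = mahler2 (\<lambda>x y. 1 - w * X x y)"
    by (rule X.mahler2_one_minus_symmetric[OF w_less_1])
       (simp add: X_def torus_mean_avg_power central_coeff_def)
  have "torus_mean (\<lambda>x y. (X x y)\<^sup>2 ^ n) = of_real (hypergeo_half_coeff n)" for n
    using torus_mean_avg_power[of "2 * n"]
    by (simp add: X_def power_mult hypergeo_half_coeff_eq_central_coeff)
  then have "Re (log_mean (w\<^sup>2)) = mahler2 (\<lambda>x y. 1 - w\<^sup>2 * (X x y)\<^sup>2)"
    using torus_contraction.mahler2_one_minus_eq_log_mean[OF
        torus_contraction_power[OF X.torus_contraction_axioms] w2_less_1]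
    by simp
  also have "\<dots> = mahler2 (\<lambda>x y. (1 - - w * X x y) * (1 - w * X x y))"
    by (simp add: algebra_simps power2_eq_square)
  also have "\<dots> = mahler2 (\<lambda>x y. 1 - - w * X x y) + mahler2 (\<lambda>x y. 1 - w * X x y)"
    using w_less_1 by (intro mahler2_mult X.torus_nonvanishing_one_minus) auto
  finally show ?thesis using symmetric by simp
qed

lemma mu_eq_log_mean:
  assumes t_bounds: "t \<noteq> 0" "cmod t < 1"
  shows "mu t = ln 4 - ln (cmod t) / 2 + Re (log_mean t) / 2"
proof -
  define w where "w = csqrt t"
  have w_props: "cmod w < 1" "w \<noteq> 0" "w\<^sup>2 = t" "cmod w = sqrt (cmod t)"
    using t_bounds by (auto simp: w_def norm_csqrt)
  have "mu t = mahler2 (\<lambda>x y. 4 / w * (1 - - w * ((x + inverse x + (y + inverse y)) / 4)))"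
  proof -
    have "4 / w * (1 - - w * (s / 4)) = 4 / w + s" for s
      using w_props(2) by (simp add: distrib_left)
    then show ?thesis by (simp only: mu_def w_def add.assoc)
  qed
  also have "\<dots> = mahler2 (\<lambda>x y. 4 / w) +
      mahler2 (\<lambda>x y. 1 - - w * ((x + inverse x + (y + inverse y)) / 4))"
    using w_props by (intro mahler2_mult torus_nonvanishing_const
        torus_contraction.torus_nonvanishing_one_minus[OF torus_contraction_avg]) auto
  also have "\<dots> = ln (cmod (4 / w)) + Re (log_mean t) / 2"
    using mahler2_one_plus_avg[OF w_props(1)] by (simp add: mahler2_const w_props(3))
  also have "ln (cmod (4 / w)) = ln 4 - ln (cmod t) / 2"
    using t_bounds by (simp add: norm_divide w_props(4) ln_div ln_sqrt)
  finally show ?thesis .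
qed

lemma G3_inverse:
  assumes t_nonzero: "t \<noteq> 0" and factored: "\<And>z. G3 z t = (z - u0) * (z - u1) * (z - u2) * (z - u3)"
  shows "t ^ 4 * G3 a (inverse t) = (1 - u0 * a) * (1 - u1 * a) * (1 - u2 * a) * (1 - u3 * a)"
proof (cases "a = 0")
  case True
  then show ?thesis using t_nonzero by (simp add: G3_def flip: power_mult power_mult_distrib)
next
  case False
  define b where "b = inverse a"
  define i where "i = inverse t"
  have b_inverse: "b * a = 1" and i_inverse: "i * t = 1"
    using False t_nonzero by (simp_all add: b_def i_def)
  have "t ^ 4 * G3 a i = a ^ 4 * G3 b t"
    unfolding G3_def using b_inverse i_inverse by algebra
  also have "\<dots> = (1 - u0 * a) * (1 - u1 * a) * (1 - u2 * a) * (1 - u3 * a)"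
    unfolding factored using b_inverse by algebra
  finally show ?thesis by (simp add: i_def)
qed

lemma mahler2_G3:
  assumes t_nonzero: "t \<noteq> 0" and factored: "\<And>z. G3 z t = (z - u0) * (z - u1) * (z - u2) * (z - u3)"
    and u_less_1: "cmod u0 < 1" "cmod u1 < 1" "cmod u2 < 1" "cmod u3 < 1"
  shows "mahler2 (\<lambda>x y. G3 ((x + inverse x)\<^sup>2 * (y + inverse y)\<^sup>2 / 16) (inverse t)) =
    Re (log_mean u0 + log_mean u1 + log_mean u2 + log_mean u3) - 4 * ln (cmod t)"
proof -
  define X where "X = (\<lambda>x y :: complex. (x + inverse x)\<^sup>2 * (y + inverse y)\<^sup>2 / 16)"
  have factor: "torus_nonvanishing (\<lambda>x y. 1 - u * X x y)"
    "mahler2 (\<lambda>x y. 1 - u * X x y) = Re (log_mean u)"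
    if "cmod u < 1" for u
    unfolding X_def
    by (rule torus_contraction.torus_nonvanishing_one_minus[OF torus_contraction_prod_sq that]
        mahler2_one_minus_prod_sq[OF that])+
  have "G3 a (inverse t) =
      (inverse t) ^ 4 * ((1 - u0 * a) * (1 - u1 * a) * (1 - u2 * a) * (1 - u3 * a))" for a
    using G3_inverse[OF t_nonzero factored, of a] t_nonzero by (simp add: field_simps)
  then have "mahler2 (\<lambda>x y. G3 (X x y) (inverse t)) = mahler2 (\<lambda>x y.
      (inverse t) ^ 4 * ((1 - u0 * X x y) * (1 - u1 * X x y) * (1 - u2 * X x y) * (1 - u3 * X x y)))"
    by simp
  also have "\<dots> = ln (cmod (inverse t ^ 4)) +
      (Re (log_mean u0) + Re (log_mean u1) + Re (log_mean u2) + Re (log_mean u3))"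
    using t_nonzero u_less_1[THEN factor(1)] u_less_1[THEN factor(2)]
    by (simp only: mahler2_mult mahler2_const torus_nonvanishing_mult torus_nonvanishing_const
        power_eq_0_iff inverse_nonzero_iff_nonzero if_False simp_thms)
  also have "ln (cmod (inverse t ^ 4)) = - 4 * ln (cmod t)"
    using t_nonzero by (simp add: norm_power norm_inverse ln_realpow ln_inverse)
  finally show ?thesis by (simp add: X_def)
qed

subsection \<open>The cubic transformation\<close>

text \<open>
  Here \<open>F = w f'\<close> and \<open>G = w g'\<close>, so both functions solve \<open>(w y')' = q y\<close>. Then \<open>w\<close> times their
  Wronskian is constant, and it vanishes at the singular point.
\<close>
lemma singular_sturm_liouville_proportional:
  fixes f g w :: "'a \<Rightarrow> 'a :: {real_normed_field, euclidean_space}"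
  assumes domain: "open S" "connected S" "x0 \<in> S" "x \<in> S"
    and deriv_f: "\<And>x. x \<in> S \<Longrightarrow> (f has_field_derivative f' x) (at x)"
    and flux_f: "\<And>x. x \<in> S \<Longrightarrow> w x * f' x = F x"
      "\<And>x. x \<in> S \<Longrightarrow> (F has_field_derivative q x * f x) (at x)"
    and deriv_g: "\<And>x. x \<in> S \<Longrightarrow> (g has_field_derivative g' x) (at x)"
    and flux_g: "\<And>x. x \<in> S \<Longrightarrow> w x * g' x = G x"
      "\<And>x. x \<in> S \<Longrightarrow> (G has_field_derivative q x * g x) (at x)"
    and singular: "w x0 = 0" "\<And>x. x \<in> S \<Longrightarrow> x \<noteq> x0 \<Longrightarrow> w x \<noteq> 0"
    and nonzero: "\<And>x. x \<in> S \<Longrightarrow> g x \<noteq> 0"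
  shows "f x * g x0 = f x0 * g x"
proof -
  define W where "W = (\<lambda>x. F x * g x - f x * G x)"
  have "(W has_field_derivative 0) (at x)" if "x \<in> S" for x
    unfolding W_def
    by (rule derivative_eq_intros deriv_f flux_f(2) deriv_g flux_g(2) that refl)+
       (simp add: flux_f(1)[OF that, symmetric] flux_g(1)[OF that, symmetric] algebra_simps)
  then have "W constant_on S"
    using domain by (intro has_field_derivative_0_imp_constant_on)
  moreover have "W x0 = 0"
    by (simp add: W_def flux_f(1)[OF domain(3), symmetric] flux_g(1)[OF domain(3), symmetric]
        singular(1))
  ultimately have "W x = 0" if "x \<in> S" for x
    using that domain(3) unfolding constant_on_def by metis
  then have "w x * (f' x * g x) = w x * (f x * g' x)" if "x \<in> S" for x
    using that flux_f(1)[OF that] flux_g(1)[OF that]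
    unfolding W_def by (metis eq_iff_diff_eq_0 mult.assoc mult.left_commute)
  then have wronskian: "f' x * g x = f x * g' x" if "x \<in> S" "x \<noteq> x0" for x
    using singular(2) that by (metis mult_left_cancel)
  have quotient: "((\<lambda>x. f x / g x) has_field_derivative (f' x * g x - f x * g' x) / (g x * g x)) (at x)"
    if "x \<in> S" for x
    using deriv_f deriv_g nonzero that by (intro DERIV_divide)
  then have "continuous_on S (\<lambda>x. f x / g x)"
    by (intro continuous_at_imp_continuous_on) (blast intro: DERIV_isCont)
  moreover have "\<forall>x\<in>S - {x0}. ((\<lambda>x. f x / g x) has_field_derivative 0) (at x)"
    using quotient wronskian by force
  ultimately obtain k where "\<And>x. x \<in> S \<Longrightarrow> f x / g x = k"
    using DERIV_zero_connected_constant[of S "{x0}" "\<lambda>x. f x / g x"] domain by blast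
  then have "f x / g x = f x0 / g x0" using domain(3,4) by metis
  then show ?thesis using nonzero[OF domain(3)] nonzero[OF domain(4)] by (simp add: frac_eq_eq)
qed

text \<open>
  Ramanujan's uniformisation of the modular equation of degree 3, which is the curve
  \<open>G3 \<alpha> \<beta> = 0\<close> with \<open>\<alpha> = cubic_mod p\<close> and \<open>\<beta> = cubic_comod p\<close>.
\<close>
definition cubic_mod :: "complex \<Rightarrow> complex" where
  "cubic_mod p = p * (2 + p) ^ 3 / (1 + 2 * p) ^ 3"

definition cubic_comod :: "complex \<Rightarrow> complex" where
  "cubic_comod p = p ^ 3 * (2 + p) / (1 + 2 * p)"

definition cubic_mod_deriv :: "complex \<Rightarrow> complex" where
  "cubic_mod_deriv p = 2 * (2 + p)\<^sup>2 * (1 - p)\<^sup>2 / (1 + 2 * p) ^ 4"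

definition cubic_comod_deriv :: "complex \<Rightarrow> complex" where
  "cubic_comod_deriv p = 6 * p\<^sup>2 * (1 + p)\<^sup>2 / (1 + 2 * p)\<^sup>2"

lemma cubic_mod_comod_0 [simp]: "cubic_mod 0 = 0" "cubic_comod 0 = 0"
  by (simp_all add: cubic_mod_def cubic_comod_def)

lemma has_field_derivative_cubic_mod:
  assumes "1 + 2 * p \<noteq> 0"
  shows "(cubic_mod has_field_derivative cubic_mod_deriv p) (at p)"
proof -
  have "((\<lambda>p. p * (2 + p) ^ 3 / (1 + 2 * p) ^ 3) has_field_derivative
      (((2 + p) ^ 3 + p * (3 * (2 + p)\<^sup>2)) * (1 + 2 * p) ^ 3
        - p * (2 + p) ^ 3 * (3 * (1 + 2 * p)\<^sup>2 * 2)) / ((1 + 2 * p) ^ 3 * (1 + 2 * p) ^ 3)) (at p)"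
    (is "(_ has_field_derivative ?D) _")
    using assms by (auto intro!: derivative_eq_intros simp: algebra_simps)
  also have "?D = cubic_mod_deriv p"
    unfolding cubic_mod_deriv_def using assms by (simp add: frac_eq_eq) algebra
  finally show ?thesis by (simp add: cubic_mod_def[abs_def])
qed

lemma has_field_derivative_cubic_comod:
  assumes "1 + 2 * p \<noteq> 0"
  shows "(cubic_comod has_field_derivative cubic_comod_deriv p) (at p)"
proof -
  have "((\<lambda>p. p ^ 3 * (2 + p) / (1 + 2 * p)) has_field_derivative
      ((3 * p\<^sup>2 * (2 + p) + p ^ 3) * (1 + 2 * p) - p ^ 3 * (2 + p) * 2) /
        ((1 + 2 * p) * (1 + 2 * p))) (at p)"
    (is "(_ has_field_derivative ?D) _")
    using assms by (auto intro!: derivative_eq_intros simp: algebra_simps)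
  also have "?D = cubic_comod_deriv p"
    unfolding cubic_comod_deriv_def using assms by (simp add: frac_eq_eq) algebra
  finally show ?thesis by (simp add: cubic_comod_def[abs_def])
qed

lemma one_minus_cubic_mod:
  "1 + 2 * p \<noteq> 0 \<Longrightarrow> 1 - cubic_mod p = (1 - p) ^ 3 * (1 + p) / (1 + 2 * p) ^ 3"
  by (simp add: cubic_mod_def field_simps) algebra

lemma one_minus_cubic_comod:
  "1 + 2 * p \<noteq> 0 \<Longrightarrow> 1 - cubic_comod p = (1 + p) ^ 3 * (1 - p) / (1 + 2 * p)"
  by (simp add: cubic_comod_def field_simps) algebra

lemma cubic_factors_nonzero:
  assumes "cmod p < 1 / 20"
  shows "1 + 2 * p \<noteq> 0" "2 + p \<noteq> 0" "1 + p \<noteq> 0" "1 - p \<noteq> 0"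
proof -
  have "a + b \<noteq> 0" if "cmod b < cmod a" for a b :: complex
    using that by (metis add_eq_0_iff norm_minus_cancel less_irrefl)
  from this[of "2 * p" 1] this[of p 2] this[of p 1] this[of "- p" 1]
  show "1 + 2 * p \<noteq> 0" "2 + p \<noteq> 0" "1 + p \<noteq> 0" "1 - p \<noteq> 0"
    using assms by (simp_all add: norm_mult)
qed

lemma norm_cubic_less_1:
  assumes "cmod p < 1 / 20"
  shows "cmod (cubic_mod p) < 1" "cmod (cubic_comod p) < 1"
proof -
  have numerator: "cmod (2 + p) \<le> 21 / 10" and denominator: "9 / 10 \<le> cmod (1 + 2 * p)"
    using norm_triangle_ineq[of 2 p] norm_diff_ineq[of 1 "2 * p"] assms by (auto simp: norm_mult)
  have "cmod p * cmod (2 + p) ^ 3 \<le> (1 / 20) * (21 / 10) ^ 3"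
    using assms numerator by (intro mult_mono power_mono) auto
  also have "\<dots> < (9 / 10) ^ 3" by (simp add: power3_eq_cube)
  also have "\<dots> \<le> cmod (1 + 2 * p) ^ 3"
    using denominator by (intro power_mono) auto
  finally show "cmod (cubic_mod p) < 1"
    using denominator by (simp add: cubic_mod_def norm_divide norm_mult norm_power divide_less_eq)
  have "cmod p ^ 3 * cmod (2 + p) \<le> (1 / 20) ^ 3 * (21 / 10)"
    using assms numerator by (intro mult_mono power_mono) auto
  also have "\<dots> < cmod (1 + 2 * p)"
    using denominator by (simp add: power3_eq_cube)
  finally show "cmod (cubic_comod p) < 1"
    using denominator by (simp add: cubic_comod_def norm_divide norm_mult norm_power divide_less_eq)
qed

definition cubic_weight :: "complex \<Rightarrow> complex" where
  "cubic_weight p = p * (2 + p) * (1 - p\<^sup>2) / (1 + 2 * p)\<^sup>2"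

lemma cubic_weight_flux:
  assumes "1 + 2 * p \<noteq> 0"
  shows "cubic_weight p * (deriv hypergeo_half (cubic_mod p) * cubic_mod_deriv p) =
      2 * hypergeo_half_flux (cubic_mod p)"
    and "cubic_weight p * (deriv hypergeo_half (cubic_comod p) * cubic_comod_deriv p) =
      6 * hypergeo_half_flux (cubic_comod p) / (1 + 2 * p)\<^sup>2"
proof -
  have "cubic_weight p * cubic_mod_deriv p = 2 * (cubic_mod p * (1 - cubic_mod p))"
    "cubic_weight p * cubic_comod_deriv p = 6 * (cubic_comod p * (1 - cubic_comod p)) / (1 + 2 * p)\<^sup>2"
    unfolding one_minus_cubic_mod[OF assms] one_minus_cubic_comod[OF assms]
      cubic_weight_def cubic_mod_deriv_def cubic_comod_deriv_def cubic_mod_def cubic_comod_def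
    using assms by (simp add: divide_simps, algebra)+
  then show "cubic_weight p * (deriv hypergeo_half (cubic_mod p) * cubic_mod_deriv p) =
      2 * hypergeo_half_flux (cubic_mod p)"
    "cubic_weight p * (deriv hypergeo_half (cubic_comod p) * cubic_comod_deriv p) =
      6 * hypergeo_half_flux (cubic_comod p) / (1 + 2 * p)\<^sup>2"
    unfolding mult.left_commute[of "cubic_weight p"] by (simp_all add: hypergeo_half_flux_def)
qed

lemma has_field_derivative_hypergeo_half_cubic_mod:
  assumes "cmod p < 1 / 20"
  shows "((\<lambda>p. hypergeo_half (cubic_mod p)) has_field_derivative
    deriv hypergeo_half (cubic_mod p) * cubic_mod_deriv p) (at p)"
  by (intro DERIV_chain2[OF has_field_derivative_hypergeo_half] has_field_derivative_cubic_mod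
      norm_cubic_less_1 cubic_factors_nonzero assms)

lemma has_field_derivative_hypergeo_half_cubic_comod:
  assumes "cmod p < 1 / 20"
  shows "((\<lambda>p. hypergeo_half (cubic_comod p)) has_field_derivative
    deriv hypergeo_half (cubic_comod p) * cubic_comod_deriv p) (at p)"
  by (intro DERIV_chain2[OF has_field_derivative_hypergeo_half] has_field_derivative_cubic_comod
      norm_cubic_less_1 cubic_factors_nonzero assms)

lemma has_field_derivative_flux_cubic_mod:
  assumes "cmod p < 1 / 20"
  shows "((\<lambda>p. 2 * hypergeo_half_flux (cubic_mod p)) has_field_derivative
    cubic_mod_deriv p / 2 * hypergeo_half (cubic_mod p)) (at p)"
proof -
  have "((\<lambda>p. hypergeo_half_flux (cubic_mod p)) has_field_derivative
      hypergeo_half (cubic_mod p) / 4 * cubic_mod_deriv p) (at p)"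
    by (intro DERIV_chain2[OF has_field_derivative_hypergeo_half_flux] has_field_derivative_cubic_mod
        norm_cubic_less_1 cubic_factors_nonzero assms)
  then show ?thesis by (auto intro!: derivative_eq_intros)
qed

lemma has_field_derivative_cubic_weight:
  assumes "1 + 2 * p \<noteq> 0"
  shows "(cubic_weight has_field_derivative
    (1 + 2 * p) * cubic_mod_deriv p / 4 - 3 * cubic_comod_deriv p / (4 * (1 + 2 * p))) (at p)"
proof -
  have "((\<lambda>p. p * (2 + p) * (1 - p\<^sup>2)) has_field_derivative 2 + 2 * p - 6 * p\<^sup>2 - 4 * p ^ 3) (at p)"
    by (rule derivative_eq_intros refl | simp)+ (simp add: algebra_simps power2_eq_square power3_eq_cube)
  moreover have "((\<lambda>p. (1 + 2 * p)\<^sup>2) has_field_derivative 4 * (1 + 2 * p)) (at p)"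
    by (auto intro!: derivative_eq_intros)
  ultimately have "((\<lambda>p. p * (2 + p) * (1 - p\<^sup>2) / (1 + 2 * p)\<^sup>2) has_field_derivative
      ((2 + 2 * p - 6 * p\<^sup>2 - 4 * p ^ 3) * (1 + 2 * p)\<^sup>2
        - p * (2 + p) * (1 - p\<^sup>2) * (4 * (1 + 2 * p))) / ((1 + 2 * p)\<^sup>2 * (1 + 2 * p)\<^sup>2)) (at p)"
    (is "(_ has_field_derivative ?D) _")
    using assms by (intro DERIV_divide) auto
  also have "?D = (1 + 2 * p) * cubic_mod_deriv p / 4 - 3 * cubic_comod_deriv p / (4 * (1 + 2 * p))"
    unfolding cubic_mod_deriv_def cubic_comod_deriv_def using assms by (simp add: divide_simps) algebra
  finally show ?thesis by (simp add: cubic_weight_def[abs_def])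
qed

definition scaled_comod :: "complex \<Rightarrow> complex" where
  "scaled_comod p = (1 + 2 * p) * hypergeo_half (cubic_comod p)"

definition scaled_comod_deriv :: "complex \<Rightarrow> complex" where
  "scaled_comod_deriv p = 2 * hypergeo_half (cubic_comod p) +
    (1 + 2 * p) * (deriv hypergeo_half (cubic_comod p) * cubic_comod_deriv p)"

definition scaled_comod_flux :: "complex \<Rightarrow> complex" where
  "scaled_comod_flux p = 2 * (cubic_weight p * hypergeo_half (cubic_comod p)) +
    6 * (hypergeo_half_flux (cubic_comod p) / (1 + 2 * p))"

lemma has_field_derivative_scaled_comod:
  assumes "cmod p < 1 / 20"
  shows "(scaled_comod has_field_derivative scaled_comod_deriv p) (at p)"
  unfolding scaled_comod_def scaled_comod_deriv_def
  by (rule derivative_eq_intros has_field_derivative_hypergeo_half_cubic_comod[OF assms] refl | simp)+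

lemma cubic_weight_mult_scaled_comod_deriv:
  assumes "1 + 2 * p \<noteq> 0"
  shows "cubic_weight p * scaled_comod_deriv p = scaled_comod_flux p"
  unfolding scaled_comod_deriv_def scaled_comod_flux_def distrib_left[of "cubic_weight p"]
    mult.left_commute[of "cubic_weight p" "1 + 2 * p"] cubic_weight_flux(2)[OF assms]
  using assms by (simp add: power2_eq_square)

lemma has_field_derivative_scaled_comod_flux:
  assumes p_small: "cmod p < 1 / 20"
  shows "(scaled_comod_flux has_field_derivative cubic_mod_deriv p / 2 * scaled_comod p) (at p)"
proof -
  define d h T where "d = 1 + 2 * p" and "h = hypergeo_half_flux" and "T = cubic_comod p"
  have d_nonzero: "d \<noteq> 0" using cubic_factors_nonzero(1)[OF p_small] by (simp add: d_def)
  have deriv_h: "((\<lambda>p. h (cubic_comod p)) has_field_derivative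
      hypergeo_half T / 4 * cubic_comod_deriv p) (at p)"
    unfolding h_def T_def
    by (intro DERIV_chain2[OF has_field_derivative_hypergeo_half_flux] has_field_derivative_cubic_comod
        norm_cubic_less_1 cubic_factors_nonzero p_small)
  have "((\<lambda>p. 2 * (cubic_weight p * hypergeo_half (cubic_comod p))
        + 6 * (h (cubic_comod p) / (1 + 2 * p))) has_field_derivative
      2 * ((d * cubic_mod_deriv p / 4 - 3 * cubic_comod_deriv p / (4 * d)) * hypergeo_half T
        + cubic_weight p * (deriv hypergeo_half T * cubic_comod_deriv p))
      + 6 * ((hypergeo_half T / 4 * cubic_comod_deriv p * d - h T * 2) / (d * d))) (at p)"
    unfolding d_def
    by (rule derivative_eq_intros has_field_derivative_cubic_weight d_nonzero[unfolded d_def]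
        has_field_derivative_hypergeo_half_cubic_comod deriv_h p_small refl | simp add: T_def)+
  also have "cubic_weight p * (deriv hypergeo_half T * cubic_comod_deriv p) = 6 * h T / d\<^sup>2"
    using cubic_weight_flux(2)[of p] d_nonzero by (simp add: T_def h_def d_def)
  also have "2 * ((d * cubic_mod_deriv p / 4 - 3 * cubic_comod_deriv p / (4 * d)) * hypergeo_half T
        + 6 * h T / d\<^sup>2) + 6 * ((hypergeo_half T / 4 * cubic_comod_deriv p * d - h T * 2) / (d * d)) =
      cubic_mod_deriv p / 2 * (d * hypergeo_half T)"
    using d_nonzero by (simp add: field_simps power2_eq_square)
  finally show ?thesis
    by (simp only: scaled_comod_flux_def[abs_def] scaled_comod_def h_def T_def d_def)
qed

theorem hypergeo_half_cubic_transformation: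
  assumes p_small: "cmod p < 1 / 20"
  shows "hypergeo_half (cubic_mod p) = (1 + 2 * p) * hypergeo_half (cubic_comod p)"
proof -
  define S :: "complex set" where "S = ball 0 (1 / 20)"
  have "hypergeo_half (cubic_mod p) * scaled_comod 0 = hypergeo_half (cubic_mod 0) * scaled_comod p"
  proof (rule singular_sturm_liouville_proportional[of S 0 p
        "\<lambda>p. hypergeo_half (cubic_mod p)" _ cubic_weight _ _ scaled_comod])
    fix x assume "x \<in> S"
    then have x_small: "cmod x < 1 / 20" by (simp add: S_def)
    note nonzero = cubic_factors_nonzero[OF x_small]
    show "((\<lambda>p. hypergeo_half (cubic_mod p)) has_field_derivative
        deriv hypergeo_half (cubic_mod x) * cubic_mod_deriv x) (at x)"
      by (rule has_field_derivative_hypergeo_half_cubic_mod[OF x_small])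
    show "((\<lambda>p. 2 * hypergeo_half_flux (cubic_mod p)) has_field_derivative
        cubic_mod_deriv x / 2 * hypergeo_half (cubic_mod x)) (at x)"
      by (rule has_field_derivative_flux_cubic_mod[OF x_small])
    show "cubic_weight x * (deriv hypergeo_half (cubic_mod x) * cubic_mod_deriv x) =
        2 * hypergeo_half_flux (cubic_mod x)"
      by (rule cubic_weight_flux(1)[OF nonzero(1)])
    show "(scaled_comod has_field_derivative scaled_comod_deriv x) (at x)"
      by (rule has_field_derivative_scaled_comod[OF x_small])
    show "(scaled_comod_flux has_field_derivative cubic_mod_deriv x / 2 * scaled_comod x) (at x)"
      by (rule has_field_derivative_scaled_comod_flux[OF x_small])
    show "cubic_weight x * scaled_comod_deriv x = scaled_comod_flux x"
      by (rule cubic_weight_mult_scaled_comod_deriv[OF nonzero(1)])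
    show "cubic_weight x \<noteq> 0" if "x \<noteq> 0"
      using nonzero that by (auto simp: cubic_weight_def power2_eq_1_iff add_eq_0_iff)
    show "scaled_comod x \<noteq> 0"
      using nonzero norm_cubic_less_1[OF x_small] by (simp add: scaled_comod_def hypergeo_half_nonzero)
  qed (use p_small in \<open>auto simp: S_def cubic_weight_def\<close>)
  then show ?thesis by (simp add: scaled_comod_def)
qed

subsection \<open>The Euler operator\<close>

definition has_euler_derivative :: "('a \<Rightarrow> 'a) \<Rightarrow> 'a \<Rightarrow> 'a :: real_normed_field \<Rightarrow> bool" where
  "has_euler_derivative f D c \<longleftrightarrow> (\<exists>f'. (f has_field_derivative f') (at c) \<and> c * f' = D)"

lemma has_euler_derivativeI:
  "(f has_field_derivative f') (at c) \<Longrightarrow> c * f' = D \<Longrightarrow> has_euler_derivative f D c"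
  by (auto simp: has_euler_derivative_def)

lemma has_euler_derivative_chain:
  assumes "(f has_field_derivative f') (at (g c))" "has_euler_derivative g D c"
  shows "has_euler_derivative (\<lambda>c. f (g c)) (f' * D) c"
proof -
  obtain g' where deriv_g: "(g has_field_derivative g') (at c)" "c * g' = D"
    using assms(2) by (auto simp: has_euler_derivative_def)
  show ?thesis
    by (rule has_euler_derivativeI[OF DERIV_chain2[OF assms(1) deriv_g(1)]])
       (simp add: deriv_g(2)[symmetric])
qed

lemma has_euler_derivative_rotate:
  assumes "has_euler_derivative f D (a * c)"
  shows "has_euler_derivative (\<lambda>c. f (a * c)) D c"
proof -
  obtain f' where deriv_f: "(f has_field_derivative f') (at (a * c))" "a * c * f' = D"
    using assms by (auto simp: has_euler_derivative_def)
  have "((\<lambda>c. f (a * c)) has_field_derivative f' * a) (at c)"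
    by (rule DERIV_chain2[where g = "\<lambda>c. a * c", OF deriv_f(1)]) (auto intro!: derivative_eq_intros)
  then show ?thesis by (rule has_euler_derivativeI) (simp add: deriv_f(2)[symmetric] mult_ac)
qed

lemma has_euler_derivative_add:
  "has_euler_derivative f D c \<Longrightarrow> has_euler_derivative g E c \<Longrightarrow>
    has_euler_derivative (\<lambda>c. f c + g c) (D + E) c"
  by (auto simp: has_euler_derivative_def distrib_left intro: DERIV_add)

lemma has_euler_derivative_cmult:
  "has_euler_derivative f D c \<Longrightarrow> has_euler_derivative (\<lambda>c. a * f c) (a * D) c"
  unfolding has_euler_derivative_def using DERIV_cmult by (metis mult.left_commute)

lemma has_euler_derivative_0_imp_constant:
  fixes f :: "'a \<Rightarrow> 'a :: {real_normed_field, euclidean_space}"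
  assumes "\<And>c. norm c < r \<Longrightarrow> has_euler_derivative f 0 c" "norm c < r"
  shows "f c = f 0"
proof -
  have deriv: "\<exists>f'. (f has_field_derivative f') (at x) \<and> (x \<noteq> 0 \<longrightarrow> f' = 0)" if "x \<in> ball 0 r" for x
    using assms(1)[of x] that by (auto simp: has_euler_derivative_def)
  have "continuous_on (ball 0 r) f"
    using deriv by (intro continuous_at_imp_continuous_on) (blast intro: DERIV_isCont)
  moreover have "\<forall>x\<in>ball 0 r - {0}. (f has_field_derivative 0) (at x)"
    using deriv by fastforce
  ultimately obtain k where "\<And>x. x \<in> ball 0 r \<Longrightarrow> f x = k"
    using DERIV_zero_connected_constant[of "ball 0 r" "{0}" f] by auto
  then show ?thesis
    using assms(2) by (metis dist_0_norm mem_ball norm_ge_zero norm_zero order_le_less_trans)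
qed

lemma has_euler_derivative_log_mean:
  assumes "has_euler_derivative g (g c * D) c" "cmod (g c) < 1"
  shows "has_euler_derivative (\<lambda>c. log_mean (g c)) (D * (1 - hypergeo_half (g c))) c"
proof -
  have "deriv log_mean (g c) * (g c * D) = D * (g c * deriv log_mean (g c))" by simp
  with has_euler_derivative_chain[OF has_field_derivative_log_mean[OF assms(2)] assms(1)]
  show ?thesis by (simp add: mult_deriv_log_mean[OF assms(2)])
qed

lemma has_euler_derivative_cubic_mod:
  assumes "has_euler_derivative g E c" "1 + 2 * g c \<noteq> 0"
    and "2 * (1 - g c)\<^sup>2 * E = g c * (2 + g c) * (1 + 2 * g c) * D"
  shows "has_euler_derivative (\<lambda>c. cubic_mod (g c)) (cubic_mod (g c) * D) c"
proof -
  have "cubic_mod_deriv (g c) * E = (2 + g c)\<^sup>2 / (1 + 2 * g c) ^ 4 * (2 * (1 - g c)\<^sup>2 * E)"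
    by (simp add: cubic_mod_deriv_def mult_ac)
  also have "\<dots> = cubic_mod (g c) * D"
    unfolding assms(3) cubic_mod_def using assms(2) by (simp add: divide_simps) algebra
  finally show ?thesis
    using has_euler_derivative_chain[OF has_field_derivative_cubic_mod assms(1)] assms(2) by simp
qed

lemma has_euler_derivative_cubic_comod:
  assumes "has_euler_derivative g E c" "1 + 2 * g c \<noteq> 0"
    and "6 * (1 + g c)\<^sup>2 * E = g c * (2 + g c) * (1 + 2 * g c) * D"
  shows "has_euler_derivative (\<lambda>c. cubic_comod (g c)) (cubic_comod (g c) * D) c"
proof -
  have "cubic_comod_deriv (g c) * E = (g c)\<^sup>2 / (1 + 2 * g c)\<^sup>2 * (6 * (1 + g c)\<^sup>2 * E)"
    by (simp add: cubic_comod_deriv_def mult_ac)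
  also have "\<dots> = cubic_comod (g c) * D"
    unfolding assms(3) cubic_comod_def using assms(2) by (simp add: divide_simps) algebra
  finally show ?thesis
    using has_euler_derivative_chain[OF has_field_derivative_cubic_comod assms(1)] assms(2) by simp
qed

subsection \<open>The tower of modular equations\<close>

text \<open>
  Apart from a spurious linear factor, \<open>cubic_comod P = cubic_mod p\<close> is the elliptic curve
  \<open>y\<^sup>2 = 1 + c\<^sup>3\<close>, where \<open>1 + 2p = y\<close> and \<open>1 + 2P = (1 + c)\<^sup>2 / y\<close>. Replacing \<open>c\<close> by \<open>\<omega> c\<close> with
  \<open>\<omega>\<^sup>3 = 1\<close> fixes \<open>p\<close> and permutes the three solutions \<open>P\<close>.
\<close>
definition cubic_param :: "complex \<Rightarrow> complex" where
  "cubic_param c = (csqrt (1 + c ^ 3) - 1) / 2"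

definition cubic_lift :: "complex \<Rightarrow> complex" where
  "cubic_lift c = ((1 + c)\<^sup>2 / csqrt (1 + c ^ 3) - 1) / 2"

lemma cubic_lift_0 [simp]: "cubic_lift 0 = 0"
  by (simp add: cubic_lift_def)

lemma cubic_param_0 [simp]: "cubic_param 0 = 0"
  by (simp add: cubic_param_def)

lemma power3_eq_cubic_param: "c ^ 3 = 4 * cubic_param c * (1 + cubic_param c)"
proof -
  have "(csqrt (1 + c ^ 3))\<^sup>2 = 1 + c ^ 3" by simp
  then show ?thesis unfolding cubic_param_def by algebra
qed

lemma cubic_param_shifts:
  fixes c :: complex
  defines "y \<equiv> csqrt (1 + c ^ 3)"
  shows "cubic_param c = (y - 1) / 2" "1 + cubic_param c = (y + 1) / 2" "1 - cubic_param c = (3 - y) / 2"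
    "2 + cubic_param c = (y + 3) / 2" "1 + 2 * cubic_param c = y"
  by (simp_all add: cubic_param_def y_def field_simps)

lemma cubic_lift_shifts:
  assumes "1 + c ^ 3 \<noteq> 0"
  defines "y \<equiv> csqrt (1 + c ^ 3)"
  shows "cubic_lift c = ((1 + c)\<^sup>2 - y) / (2 * y)" "1 + cubic_lift c = ((1 + c)\<^sup>2 + y) / (2 * y)"
    "1 - cubic_lift c = (3 * y - (1 + c)\<^sup>2) / (2 * y)"
    "2 + cubic_lift c = ((1 + c)\<^sup>2 + 3 * y) / (2 * y)"
    "1 + 2 * cubic_lift c = (1 + c)\<^sup>2 / y"
proof -
  have "y \<noteq> 0" using assms by simp
  then show "cubic_lift c = ((1 + c)\<^sup>2 - y) / (2 * y)" "1 + cubic_lift c = ((1 + c)\<^sup>2 + y) / (2 * y)"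
    "1 - cubic_lift c = (3 * y - (1 + c)\<^sup>2) / (2 * y)"
    "2 + cubic_lift c = ((1 + c)\<^sup>2 + 3 * y) / (2 * y)"
    "1 + 2 * cubic_lift c = (1 + c)\<^sup>2 / y"
    unfolding cubic_lift_def y_def[symmetric] by (simp_all add: field_simps)
qed

lemma cubic_comod_lift:
  assumes "1 + c ^ 3 \<noteq> 0"
  shows "cubic_comod (cubic_lift c) = cubic_mod (cubic_param c)"
proof -
  define y where "y = csqrt (1 + c ^ 3)"
  have y_props: "y \<noteq> 0" "y\<^sup>2 = 1 + c ^ 3" using assms by (simp_all add: y_def)
  have c_nonzero: "1 + c \<noteq> 0" using assms by (auto simp: add_eq_0_iff minus_equation_iff[of c])
  have "((1 + c)\<^sup>2 - y) ^ 3 * ((1 + c)\<^sup>2 + 3 * y) = (1 + c)\<^sup>2 * (y - 1) * (y + 3) ^ 3"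
    using y_props(2) by algebra
  then show ?thesis
    unfolding cubic_comod_def cubic_mod_def cubic_param_shifts cubic_lift_shifts[OF assms]
      y_def[symmetric]
    using y_props(1) c_nonzero by (simp add: divide_simps) algebra
qed

lemma one_minus_cubic_lift:
  assumes "1 + c ^ 3 \<noteq> 0"
  shows "(1 - cubic_lift c) * (1 - (cubic_param c)\<^sup>2) = (1 + cubic_lift c) * (1 + cubic_param c - c)\<^sup>2"
proof -
  define y where "y = csqrt (1 + c ^ 3)"
  have y_props: "y \<noteq> 0" "y\<^sup>2 = 1 + c ^ 3" using assms by (simp_all add: y_def)
  have "(3 * y - (1 + c)\<^sup>2) * ((y + 1) * (3 - y)) = ((1 + c)\<^sup>2 + y) * (y + 1 - 2 * c)\<^sup>2"
    using y_props(2) by algebra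
  moreover have "1 - (cubic_param c)\<^sup>2 = (1 + cubic_param c) * (1 - cubic_param c)"
    by algebra
  ultimately show ?thesis
    unfolding cubic_param_shifts cubic_lift_shifts[OF assms] y_def[symmetric]
    using y_props(1) by (simp add: divide_simps) algebra
qed

lemma one_plus_power3_not_nonpos_Reals: "cmod c < 1 \<Longrightarrow> 1 + c ^ 3 \<notin> \<real>\<^sub>\<le>\<^sub>0"
  using one_minus_not_nonpos_Reals[of "- (c ^ 3)"] by (simp add: norm_power power_less_one_iff)

lemma one_plus_power3_nonzero: "cmod c < 1 \<Longrightarrow> 1 + c ^ 3 \<noteq> 0"
  using one_plus_power3_not_nonpos_Reals[of c] by auto

lemma has_euler_derivative_cubic_param:
  assumes "cmod c < 1"
  shows "has_euler_derivative cubic_param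
    (3 * cubic_param c * (1 + cubic_param c) / (1 + 2 * cubic_param c)) c"
proof (rule has_euler_derivativeI)
  show "(cubic_param has_field_derivative (3 * c\<^sup>2 / (4 * csqrt (1 + c ^ 3)))) (at c)"
    unfolding cubic_param_def using one_plus_power3_not_nonpos_Reals[OF assms]
    by (auto intro!: derivative_eq_intros)
  have "c * (3 * c\<^sup>2 / (4 * csqrt (1 + c ^ 3))) = 3 * c ^ 3 / (4 * csqrt (1 + c ^ 3))"
    by (simp add: power2_eq_square power3_eq_cube)
  then show "c * (3 * c\<^sup>2 / (4 * csqrt (1 + c ^ 3))) =
      3 * cubic_param c * (1 + cubic_param c) / (1 + 2 * cubic_param c)"
    using power3_eq_cubic_param[of c] by (simp add: cubic_param_shifts(5))
qed

lemma has_euler_derivative_cubic_lift: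
  assumes "cmod c < 1"
  shows "has_euler_derivative cubic_lift
    (c * (1 + c)\<^sup>2 * (2 - c)\<^sup>2 / (4 * (1 + 2 * cubic_param c) ^ 3)) c"
proof (rule has_euler_derivativeI)
  define y where "y = csqrt (1 + c ^ 3)"
  have y_props: "y \<noteq> 0" "y\<^sup>2 = 1 + c ^ 3"
    using one_plus_power3_not_nonpos_Reals[OF assms] by (auto simp: y_def)
  have "((\<lambda>c. csqrt (1 + c ^ 3)) has_field_derivative 3 * c\<^sup>2 / (2 * y)) (at c)"
    unfolding y_def using one_plus_power3_not_nonpos_Reals[OF assms]
    by (auto intro!: derivative_eq_intros)
  moreover have "((\<lambda>c. (1 + c)\<^sup>2) has_field_derivative 2 * (1 + c)) (at c)"
    by (auto intro!: derivative_eq_intros)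
  ultimately have "((\<lambda>c. (1 + c)\<^sup>2 / csqrt (1 + c ^ 3)) has_field_derivative
      (2 * (1 + c) * y - (1 + c)\<^sup>2 * (3 * c\<^sup>2 / (2 * y))) / (y * y)) (at c)"
    using y_props(1) unfolding y_def by (intro DERIV_divide)
  then have "((\<lambda>c. ((1 + c)\<^sup>2 / csqrt (1 + c ^ 3) - 1) / 2) has_field_derivative
      ((2 * (1 + c) * y - (1 + c)\<^sup>2 * (3 * c\<^sup>2 / (2 * y))) / (y * y) - 0) / 2) (at c)"
    by (intro DERIV_cdivide DERIV_diff DERIV_const)
  also have "((2 * (1 + c) * y - (1 + c)\<^sup>2 * (3 * c\<^sup>2 / (2 * y))) / (y * y) - 0) / 2 =
      (1 + c)\<^sup>2 * (2 - c)\<^sup>2 / (4 * y ^ 3)"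
  proof -
    have "4 * (1 + c) * y\<^sup>2 - 3 * (1 + c)\<^sup>2 * c\<^sup>2 = (1 + c)\<^sup>2 * (2 - c)\<^sup>2"
      using y_props(2) by algebra
    then show ?thesis using y_props(1) by (simp add: divide_simps) algebra
  qed
  finally show "(cubic_lift has_field_derivative (1 + c)\<^sup>2 * (2 - c)\<^sup>2 / (4 * y ^ 3)) (at c)"
    by (simp add: cubic_lift_def[abs_def])
  show "c * ((1 + c)\<^sup>2 * (2 - c)\<^sup>2 / (4 * y ^ 3)) =
      c * (1 + c)\<^sup>2 * (2 - c)\<^sup>2 / (4 * (1 + 2 * cubic_param c) ^ 3)"
    by (simp add: cubic_param_shifts(5) y_def mult.assoc)
qed

lemma norm_cubic_param_lift_less:
  assumes c_small: "cmod c < 1 / 25"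
  shows "cmod (cubic_param c) < 1 / 20" "cmod (cubic_lift c) < 1 / 20"
proof -
  define y where "y = csqrt (1 + c ^ 3)"
  have "cmod c ^ 3 \<le> (1 / 25) ^ 3" using c_small by (intro power_mono) auto
  then have norm_c3: "cmod (c ^ 3) \<le> 1 / 15625" by (simp add: norm_power power_divide)
  have "0 \<le> Re y" unfolding y_def by (rule Re_csqrt)
  then have "1 \<le> cmod (y + 1)" using complex_Re_le_cmod[of "y + 1"] by simp
  then have "cmod (y - 1) \<le> cmod (y - 1) * cmod (y + 1)" by (simp add: mult_le_cancel_left1)
  also have "\<dots> = cmod (c ^ 3)"
  proof -
    have "y\<^sup>2 = 1 + c ^ 3" by (simp add: y_def)
    then have "(y - 1) * (y + 1) = c ^ 3" by algebra
    then show ?thesis by (simp only: norm_mult[symmetric])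
  qed
  finally have norm_y_minus_1: "cmod (y - 1) \<le> 1 / 15625" using norm_c3 by linarith
  then show "cmod (cubic_param c) < 1 / 20"
    by (simp add: cubic_param_def y_def norm_divide)
  have norm_y: "9 / 10 \<le> cmod y"
    using norm_triangle_ineq3[of y "1 :: complex"] norm_y_minus_1 by simp
  have "cmod (c * c) \<le> (1 / 25) * (1 / 25)"
    unfolding norm_mult using c_small by (intro mult_mono) auto
  then have "cmod (2 * c + c * c - (y - 1)) \<le> 2 / 25 + 1 / 625 + 1 / 15625"
    using norm_triangle_ineq4[of "2 * c + c * c" "y - 1"] norm_triangle_ineq[of "2 * c" "c * c"]
      norm_y_minus_1 c_small
    by (simp add: norm_mult)
  also have "2 * c + c * c - (y - 1) = (1 + c)\<^sup>2 - y"
    by (simp add: power2_eq_square algebra_simps)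
  finally have "cmod ((1 + c)\<^sup>2 - y) \<le> 2 / 25 + 1 / 625 + 1 / 15625" .
  moreover have "1 + c ^ 3 \<noteq> 0" using norm_y by (auto simp: y_def)
  ultimately show "cmod (cubic_lift c) < 1 / 20"
    using norm_y by (simp add: cubic_lift_shifts(1) y_def norm_divide norm_mult divide_less_eq)
qed

lemma hypergeo_half_cubic_lift:
  assumes "cmod c < 1 / 25"
  shows "hypergeo_half (cubic_mod (cubic_lift c)) =
    (1 + c)\<^sup>2 * hypergeo_half (cubic_comod (cubic_param c))"
proof -
  define p P where "p = cubic_param c" and "P = cubic_lift c"
  have c3_nonzero: "1 + c ^ 3 \<noteq> 0" using assms by (intro one_plus_power3_nonzero) simp
  have "hypergeo_half (cubic_mod P) = (1 + 2 * P) * ((1 + 2 * p) * hypergeo_half (cubic_comod p))"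
    using norm_cubic_param_lift_less[OF assms] cubic_comod_lift[OF c3_nonzero]
    by (simp add: P_def p_def hypergeo_half_cubic_transformation)
  also have "(1 + 2 * P) * ((1 + 2 * p) * hypergeo_half (cubic_comod p)) =
      (1 + c)\<^sup>2 * hypergeo_half (cubic_comod p)"
    using c3_nonzero by (simp add: P_def p_def cubic_lift_shifts(5) cubic_param_shifts(5))
  finally show ?thesis by (simp add: P_def p_def)
qed

subsection \<open>The Hecke relation\<close>

text \<open>
  Along \<open>cubic_param\<close> the logarithmic Euler derivative of \<open>cubic_mod p\<close> is
  \<open>3 (1 - p\<^sup>2)\<^sup>2 cubic_rate p\<close>; the other derivatives are polynomial multiples of the same rate.
\<close>
definition cubic_rate :: "complex \<Rightarrow> complex" where
  "cubic_rate p = 2 / ((1 + p) * (2 + p) * (1 + 2 * p)\<^sup>2)"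

lemma one_plus_cubic_lift_rate:
  assumes c_small: "cmod c < 1 / 25"
  defines "p \<equiv> cubic_param c" and "P \<equiv> cubic_lift c"
  shows "2 * (1 + P)\<^sup>2 * (c * (1 + c)\<^sup>2 * (2 - c)\<^sup>2 / (4 * (1 + 2 * p) ^ 3)) =
    P * (2 + P) * (1 + 2 * P) * (cubic_rate p * ((1 + p) * (1 - p))\<^sup>2)"
proof -
  define y where "y = csqrt (1 + c ^ 3)"
  define X where "X = (1 + c)\<^sup>2"
  have c3_nonzero: "1 + c ^ 3 \<noteq> 0" using c_small by (intro one_plus_power3_nonzero) simp
  have y_props: "y \<noteq> 0" "y\<^sup>2 = 1 + c ^ 3" using c3_nonzero by (simp_all add: y_def)
  note nonzero = cubic_factors_nonzero[OF norm_cubic_param_lift_less(1)[OF c_small], folded p_def]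
  have y_shifts: "y + 3 \<noteq> 0" "y + 1 \<noteq> 0"
    using nonzero(2,3) unfolding p_def cubic_param_shifts(2,4) y_def[symmetric] by simp_all
  have "c * (2 - c)\<^sup>2 * (X + y)\<^sup>2 * (y + 3) = (X - y) * (X + 3 * y) * (3 - y)\<^sup>2 * (y + 1)"
    unfolding X_def using y_props(2) by algebra
  then have "c * (2 - c)\<^sup>2 * (X + y)\<^sup>2 = (X - y) * (X + 3 * y) * (3 - y)\<^sup>2 * (y + 1) / (y + 3)"
    using y_shifts by (simp add: eq_divide_eq)
  moreover have "2 * (1 + P)\<^sup>2 * (c * (1 + c)\<^sup>2 * (2 - c)\<^sup>2 / (4 * (1 + 2 * p) ^ 3)) =
      X / (8 * y ^ 5) * (c * (2 - c)\<^sup>2 * (X + y)\<^sup>2)"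
    unfolding p_def P_def cubic_param_shifts(5) cubic_lift_shifts(2)[OF c3_nonzero]
      y_def[symmetric] X_def[symmetric]
    using y_props(1) by (simp add: field_simps eval_nat_numeral)
  moreover have "cubic_rate p * ((1 + p) * (1 - p))\<^sup>2 = (y + 1) * (3 - y)\<^sup>2 / (2 * ((y + 3) * y\<^sup>2))"
    unfolding cubic_rate_def p_def cubic_param_shifts(2-5) y_def[symmetric]
    using y_shifts by (simp add: power_divide power_mult_distrib power2_eq_square[of "y + 1"])
  moreover have "P * (2 + P) * (1 + 2 * P) = (X - y) * (X + 3 * y) * X / (4 * y ^ 3)"
    unfolding P_def cubic_lift_shifts(4,5)[OF c3_nonzero]
    unfolding cubic_lift_shifts(1)[OF c3_nonzero] y_def[symmetric] X_def[symmetric]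
    by (simp add: power3_eq_cube)
  ultimately show ?thesis by (simp add: eval_nat_numeral mult_ac)
qed

lemma one_minus_cubic_lift_rate:
  assumes c_small: "cmod c < 1 / 25"
  defines "p \<equiv> cubic_param c" and "P \<equiv> cubic_lift c"
  shows "2 * (1 - P)\<^sup>2 * (c * (1 + c)\<^sup>2 * (2 - c)\<^sup>2 / (4 * (1 + 2 * p) ^ 3)) =
    P * (2 + P) * (1 + 2 * P) * (cubic_rate p * (1 + p - c) ^ 4)"
proof -
  define k where "k = (1 + p) * (1 - p)"
  define E where "E = c * (1 + c)\<^sup>2 * (2 - c)\<^sup>2 / (4 * (1 + 2 * p) ^ 3)"
  have c3_nonzero: "1 + c ^ 3 \<noteq> 0" using c_small by (intro one_plus_power3_nonzero) simp
  note nonzero = cubic_factors_nonzero[OF norm_cubic_param_lift_less(1)[OF c_small], folded p_def]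
  have "k\<^sup>2 * (2 * (1 - P)\<^sup>2 * E) = 2 * ((1 - P) * k)\<^sup>2 * E"
    by (simp add: power_mult_distrib mult_ac)
  also have "(1 - P) * k = (1 + P) * (1 + p - c)\<^sup>2"
    using one_minus_cubic_lift[OF c3_nonzero, folded p_def P_def]
    by (simp add: k_def power2_eq_square algebra_simps)
  also have "2 * ((1 + P) * (1 + p - c)\<^sup>2)\<^sup>2 * E = 2 * (1 + P)\<^sup>2 * E * (1 + p - c) ^ 4"
    by (simp add: power_mult_distrib mult_ac flip: power_mult)
  also have "2 * (1 + P)\<^sup>2 * E = P * (2 + P) * (1 + 2 * P) * (cubic_rate p * k\<^sup>2)"
    unfolding E_def k_def p_def P_def by (rule one_plus_cubic_lift_rate[OF c_small])
  also have "\<dots> * (1 + p - c) ^ 4 = k\<^sup>2 * (P * (2 + P) * (1 + 2 * P) * (cubic_rate p * (1 + p - c) ^ 4))"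
    by (simp add: mult_ac)
  finally have "2 * (1 - P)\<^sup>2 * E = P * (2 + P) * (1 + 2 * P) * (cubic_rate p * (1 + p - c) ^ 4)"
    using nonzero by (simp add: k_def)
  then show ?thesis unfolding E_def .
qed

lemma has_euler_derivative_log_mean_cubic_lift:
  assumes c_small: "cmod c < 1 / 25"
  defines "p \<equiv> cubic_param c"
  shows "has_euler_derivative (\<lambda>c. log_mean (cubic_mod (cubic_lift c)))
    (cubic_rate p * (1 + p - c) ^ 4 * (1 - (1 + c)\<^sup>2 * hypergeo_half (cubic_comod p))) c"
proof -
  note small = norm_cubic_param_lift_less(2)[OF c_small]
  have "has_euler_derivative (\<lambda>c. cubic_mod (cubic_lift c))
      (cubic_mod (cubic_lift c) * (cubic_rate p * (1 + p - c) ^ 4)) c"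
    unfolding p_def
    by (rule has_euler_derivative_cubic_mod[OF has_euler_derivative_cubic_lift
          cubic_factors_nonzero(1)[OF small] one_minus_cubic_lift_rate[OF c_small]]) (use c_small in simp)
  from has_euler_derivative_log_mean[OF this norm_cubic_less_1(1)[OF small]]
  show ?thesis by (simp only: p_def hypergeo_half_cubic_lift[OF c_small])
qed

lemma has_euler_derivative_log_mean_cubic_param:
  assumes c_small: "cmod c < 1 / 25"
  defines "p \<equiv> cubic_param c"
  shows "has_euler_derivative (\<lambda>c. log_mean (cubic_mod (cubic_param c)))
      (cubic_rate p * (3 * (1 - p\<^sup>2)\<^sup>2) * (1 - (1 + 2 * p) * hypergeo_half (cubic_comod p))) c"
    and "has_euler_derivative (\<lambda>c. log_mean (cubic_comod (cubic_param c)))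
      (cubic_rate p * (9 * (1 + p) ^ 4) * (1 - hypergeo_half (cubic_comod p))) c"
proof -
  note small = norm_cubic_param_lift_less(1)[OF c_small, folded p_def]
  note nonzero = cubic_factors_nonzero[OF small]
  have euler: "has_euler_derivative cubic_param (3 * p * (1 + p) / (1 + 2 * p)) c"
    unfolding p_def using c_small by (intro has_euler_derivative_cubic_param) simp
  have "2 * (1 - p)\<^sup>2 * (3 * p * (1 + p) / (1 + 2 * p)) =
      p * (2 + p) * (1 + 2 * p) * (cubic_rate p * (3 * (1 - p\<^sup>2)\<^sup>2))"
    unfolding cubic_rate_def using nonzero by (simp add: divide_simps) algebra
  then have "has_euler_derivative (\<lambda>c. cubic_mod (cubic_param c))
      (cubic_mod p * (cubic_rate p * (3 * (1 - p\<^sup>2)\<^sup>2))) c"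
    using euler nonzero unfolding p_def by (intro has_euler_derivative_cubic_mod)
  then show "has_euler_derivative (\<lambda>c. log_mean (cubic_mod (cubic_param c)))
      (cubic_rate p * (3 * (1 - p\<^sup>2)\<^sup>2) * (1 - (1 + 2 * p) * hypergeo_half (cubic_comod p))) c"
    using norm_cubic_less_1(1)[OF small]
    unfolding p_def hypergeo_half_cubic_transformation[OF small, unfolded p_def, symmetric]
    by (intro has_euler_derivative_log_mean)
  have "6 * (1 + p)\<^sup>2 * (3 * p * (1 + p) / (1 + 2 * p)) =
      p * (2 + p) * (1 + 2 * p) * (cubic_rate p * (9 * (1 + p) ^ 4))"
    unfolding cubic_rate_def using nonzero by (simp add: divide_simps) algebra
  then have "has_euler_derivative (\<lambda>c. cubic_comod (cubic_param c))
      (cubic_comod p * (cubic_rate p * (9 * (1 + p) ^ 4))) c"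
    using euler nonzero unfolding p_def by (intro has_euler_derivative_cubic_comod)
  then show "has_euler_derivative (\<lambda>c. log_mean (cubic_comod (cubic_param c)))
      (cubic_rate p * (9 * (1 + p) ^ 4) * (1 - hypergeo_half (cubic_comod p))) c"
    using norm_cubic_less_1(2)[OF small] unfolding p_def by (intro has_euler_derivative_log_mean)
qed

lemma has_euler_derivative_Ln_linear:
  assumes "has_euler_derivative g D c" "cmod (a * g c) < 1"
  shows "has_euler_derivative (\<lambda>c. Ln (1 + a * g c)) (a / (1 + a * g c) * D) c"
proof -
  have "1 + a * g c \<notin> \<real>\<^sub>\<le>\<^sub>0"
    using one_minus_not_nonpos_Reals[of "- (a * g c)"] assms(2) by simp
  moreover have "((\<lambda>p. 1 + a * p) has_field_derivative a) (at (g c))"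
    by (auto intro!: derivative_eq_intros)
  ultimately have "((\<lambda>p. Ln (1 + a * p)) has_field_derivative inverse (1 + a * g c) * a) (at (g c))"
    by (intro DERIV_chain2[where f = Ln] has_field_derivative_Ln)
  from has_euler_derivative_chain[where g = g, OF this assms(1)]
  show ?thesis by (simp add: divide_inverse mult_ac)
qed

lemma has_euler_derivative_Ln_cubic_param:
  assumes c_small: "cmod c < 1 / 25"
  defines "p \<equiv> cubic_param c"
  shows "has_euler_derivative (\<lambda>c. Ln (1 + 2 * cubic_param c))
      (cubic_rate p * (3 * p * (1 + p)\<^sup>2 * (2 + p))) c"
    and "has_euler_derivative (\<lambda>c. Ln (1 + cubic_param c / 2))
      (cubic_rate p * (3 / 2 * p * (1 + p)\<^sup>2 * (1 + 2 * p))) c"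
proof -
  note small = norm_cubic_param_lift_less(1)[OF c_small, folded p_def]
  note nonzero = cubic_factors_nonzero[OF small]
  define D where "D = 3 * p * (1 + p) / (1 + 2 * p)"
  have euler: "has_euler_derivative cubic_param D c"
    unfolding D_def p_def using c_small by (intro has_euler_derivative_cubic_param) simp
  have less_1: "cmod (2 * cubic_param c) < 1" "cmod (1 / 2 * cubic_param c) < 1"
    using small by (simp_all add: p_def norm_mult)
  have "2 / (1 + 2 * p) * D = cubic_rate p * (3 * p * (1 + p)\<^sup>2 * (2 + p))"
    unfolding D_def cubic_rate_def using nonzero by (simp add: divide_simps) algebra
  with has_euler_derivative_Ln_linear[OF euler less_1(1)]
  show "has_euler_derivative (\<lambda>c. Ln (1 + 2 * cubic_param c))
      (cubic_rate p * (3 * p * (1 + p)\<^sup>2 * (2 + p))) c"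
    by (simp only: p_def)
  have "1 + 1 / 2 * p = (2 + p) / 2" by (simp add: field_simps)
  then have "1 / 2 / (1 + 1 / 2 * p) * D = D / (2 + p)" by simp
  also have "\<dots> = cubic_rate p * (3 / 2 * p * (1 + p)\<^sup>2 * (1 + 2 * p))"
    unfolding D_def cubic_rate_def using nonzero by (simp add: divide_simps) algebra
  finally have "1 / 2 / (1 + 1 / 2 * p) * D = cubic_rate p * (3 / 2 * p * (1 + p)\<^sup>2 * (1 + 2 * p))" .
  with has_euler_derivative_Ln_linear[OF euler less_1(2)]
  have "has_euler_derivative (\<lambda>c. Ln (1 + 1 / 2 * cubic_param c))
      (cubic_rate p * (3 / 2 * p * (1 + p)\<^sup>2 * (1 + 2 * p))) c"
    by (simp only: p_def)
  then show "has_euler_derivative (\<lambda>c. Ln (1 + cubic_param c / 2))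
      (cubic_rate p * (3 / 2 * p * (1 + p)\<^sup>2 * (1 + 2 * p))) c" by simp
qed

lemma sum_over_cube_roots_of_unity:
  fixes a c \<omega> :: complex
  assumes "\<omega>\<^sup>2 + \<omega> + 1 = 0"
  shows "(a - c) ^ 4 + (a - \<omega> * c) ^ 4 + (a - \<omega>\<^sup>2 * c) ^ 4 = 3 * a * (a ^ 3 - 4 * c ^ 3)"
    and "(a - c) ^ 4 * (1 + c)\<^sup>2 + (a - \<omega> * c) ^ 4 * (1 + \<omega> * c)\<^sup>2
        + (a - \<omega>\<^sup>2 * c) ^ 4 * (1 + \<omega>\<^sup>2 * c)\<^sup>2 =
      3 * ((a\<^sup>2 + c ^ 3)\<^sup>2 + 2 * (a\<^sup>2 - 2 * a) * (1 - 2 * a) * c ^ 3)"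
  using assms by algebra+

lemma cube_root_of_unity:
  fixes \<omega> :: complex
  assumes "\<omega>\<^sup>2 + \<omega> + 1 = 0"
  shows "\<omega> ^ 3 = 1" "(\<omega>\<^sup>2) ^ 3 = 1" "cmod \<omega> = 1" "cmod (\<omega>\<^sup>2) = 1"
    and "\<omega> \<noteq> 1" "\<omega>\<^sup>2 \<noteq> 1" "\<omega>\<^sup>2 \<noteq> \<omega>"
proof -
  show cube: "\<omega> ^ 3 = 1" "(\<omega>\<^sup>2) ^ 3 = 1" using assms by algebra+
  then show "cmod \<omega> = 1" "cmod (\<omega>\<^sup>2) = 1"
    using power_eq_1_iff[of \<omega> 3] power_eq_1_iff[of "\<omega>\<^sup>2" 3] by simp_all
  show "\<omega> \<noteq> 1" using assms by auto
  then show "\<omega>\<^sup>2 \<noteq> 1" "\<omega>\<^sup>2 \<noteq> \<omega>"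
    using cube(1) by (auto simp: power3_eq_cube power2_eq_square)
qed

lemma cubic_param_rotate: "a ^ 3 = 1 \<Longrightarrow> cubic_param (a * c) = cubic_param c"
  by (simp add: cubic_param_def power_mult_distrib)

lemma hecke_euler_sum:
  fixes p c Y \<omega> :: complex
  assumes omega: "\<omega>\<^sup>2 + \<omega> + 1 = 0" and c_cube: "c ^ 3 = 4 * p * (1 + p)"
  defines "L \<equiv> \<lambda>c. (1 + p - c) ^ 4 * (1 - (1 + c)\<^sup>2 * Y)"
  shows "L c + L (\<omega> * c) + L (\<omega>\<^sup>2 * c) =
    27 * (1 + p) ^ 4 * (1 - Y) - 24 * (1 - p\<^sup>2)\<^sup>2 * (1 - (1 + 2 * p) * Y) - 144 * p * (1 + p)\<^sup>2"
proof -
  have "L c + L (\<omega> * c) + L (\<omega>\<^sup>2 * c) =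
      ((1 + p - c) ^ 4 + (1 + p - \<omega> * c) ^ 4 + (1 + p - \<omega>\<^sup>2 * c) ^ 4) -
      ((1 + p - c) ^ 4 * (1 + c)\<^sup>2 + (1 + p - \<omega> * c) ^ 4 * (1 + \<omega> * c)\<^sup>2
        + (1 + p - \<omega>\<^sup>2 * c) ^ 4 * (1 + \<omega>\<^sup>2 * c)\<^sup>2) * Y"
    by (simp add: L_def algebra_simps)
  also have "\<dots> = 27 * (1 + p) ^ 4 * (1 - Y) - 24 * (1 - p\<^sup>2)\<^sup>2 * (1 - (1 + 2 * p) * Y)
      - 144 * p * (1 + p)\<^sup>2"
    unfolding sum_over_cube_roots_of_unity[OF omega] c_cube by algebra
  finally show ?thesis .
qed

definition hecke_defect :: "complex \<Rightarrow> complex \<Rightarrow> complex" where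
  "hecke_defect \<omega> c = log_mean (cubic_mod (cubic_lift c)) + log_mean (cubic_mod (cubic_lift (\<omega> * c)))
    + log_mean (cubic_mod (cubic_lift (\<omega>\<^sup>2 * c))) + (-3) * log_mean (cubic_comod (cubic_param c))
    + 8 * log_mean (cubic_mod (cubic_param c)) + (-32) * Ln (1 + cubic_param c / 2)
    + 32 * Ln (1 + 2 * cubic_param c)"

lemma has_euler_derivative_hecke_defect:
  assumes omega: "\<omega>\<^sup>2 + \<omega> + 1 = 0" and c_small: "cmod c < 1 / 25"
  shows "has_euler_derivative (hecke_defect \<omega>) 0 c"
proof -
  define p where "p = cubic_param c"
  define Y where "Y = hypergeo_half (cubic_comod p)"
  define L where "L = (\<lambda>c. (1 + p - c) ^ 4 * (1 - (1 + c)\<^sup>2 * Y))"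
  have lift: "has_euler_derivative (\<lambda>c. log_mean (cubic_mod (cubic_lift (a * c))))
      (cubic_rate p * L (a * c)) c"
    if "a ^ 3 = 1" "cmod a = 1" for a
    using has_euler_derivative_log_mean_cubic_lift[of "a * c"] c_small that
    by (intro has_euler_derivative_rotate)
       (simp add: L_def Y_def p_def cubic_param_rotate norm_mult mult.assoc)
  have "has_euler_derivative (hecke_defect \<omega>) (cubic_rate p * L c + cubic_rate p * L (\<omega> * c)
    + cubic_rate p * L (\<omega>\<^sup>2 * c)
    + (-3) * (cubic_rate p * (9 * (1 + p) ^ 4) * (1 - Y))
    + 8 * (cubic_rate p * (3 * (1 - p\<^sup>2)\<^sup>2) * (1 - (1 + 2 * p) * Y))
    + (-32) * (cubic_rate p * (3 / 2 * p * (1 + p)\<^sup>2 * (1 + 2 * p)))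
    + 32 * (cubic_rate p * (3 * p * (1 + p)\<^sup>2 * (2 + p)))) c" (is "has_euler_derivative _ ?D _")
    using lift[of 1] lift[of \<omega>] lift[of "\<omega>\<^sup>2"] cube_root_of_unity[OF omega]
      has_euler_derivative_log_mean_cubic_param[OF c_small]
      has_euler_derivative_Ln_cubic_param[OF c_small]
    unfolding hecke_defect_def Y_def p_def
    by (intro has_euler_derivative_add has_euler_derivative_cmult) simp_all
  also have "?D = cubic_rate p * (L c + L (\<omega> * c) + L (\<omega>\<^sup>2 * c) - 27 * (1 + p) ^ 4 * (1 - Y)
      + 24 * (1 - p\<^sup>2)\<^sup>2 * (1 - (1 + 2 * p) * Y) + 144 * p * (1 + p)\<^sup>2)"
    by (simp add: field_simps)
  also have "\<dots> = 0"
    unfolding L_def hecke_euler_sum[OF omega power3_eq_cubic_param[of c, folded p_def]] by simp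
  finally show ?thesis .
qed

theorem log_mean_hecke:
  assumes "\<omega>\<^sup>2 + \<omega> + 1 = 0" "cmod c < 1 / 25"
  defines "p \<equiv> cubic_param c"
  shows "log_mean (cubic_mod (cubic_lift c)) + log_mean (cubic_mod (cubic_lift (\<omega> * c)))
      + log_mean (cubic_mod (cubic_lift (\<omega>\<^sup>2 * c))) =
    3 * log_mean (cubic_comod p) - 8 * log_mean (cubic_mod p) + 32 * Ln (1 + p / 2) - 32 * Ln (1 + 2 * p)"
proof -
  have "hecke_defect \<omega> c = hecke_defect \<omega> 0"
    using has_euler_derivative_hecke_defect[OF assms(1)] assms(2)
    by (rule has_euler_derivative_0_imp_constant)
  also have "\<dots> = 0" by (simp add: hecke_defect_def)
  finally show ?thesis by (simp add: hecke_defect_def p_def algebra_simps)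
qed

subsection \<open>The roots of G3\<close>

lemma G3_cubic:
  assumes "1 + 2 * p \<noteq> 0"
  shows "G3 (cubic_mod p) (cubic_comod p) = 0"
proof -
  define e i where "e = 2 + p" and "i = inverse (1 + 2 * p)"
  have i_inverse: "i * (1 + 2 * p) = 1" using assms by (simp add: i_def)
  have "cubic_mod p = p * e ^ 3 * i ^ 3" "cubic_comod p = p ^ 3 * e * i"
    by (simp_all add: cubic_mod_def cubic_comod_def e_def i_def field_simps)
  moreover have "G3 (p * e ^ 3 * i ^ 3) (p ^ 3 * e * i) = 0"
    using i_inverse unfolding G3_def e_def by algebra
  ultimately show ?thesis by simp
qed

lemma G3_commute: "G3 a b = G3 b a"
  unfolding G3_def by algebra

lemma monic_quartic_factor:
  fixes w x y z :: "'a :: field"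
  assumes "\<And>v. v \<in> {w, x, y, z} \<Longrightarrow> v ^ 4 + a * v ^ 3 + b * v\<^sup>2 + c * v + d = 0"
    and "card {w, x, y, z} = 4"
  shows "v ^ 4 + a * v ^ 3 + b * v\<^sup>2 + c * v + d = (v - w) * (v - x) * (v - y) * (v - z)"
proof -
  define p where "p = [:d, c, b, a, 1:]"
  define q where "q = [:-w, 1:] * [:-x, 1:] * [:-y, 1:] * [:-z, 1:]"
  have "p = q"
  proof (rule poly_eqI_degree_lead_coeff[where n = 4 and A = "{w, x, y, z}"])
    show "poly p v = poly q v" if "v \<in> {w, x, y, z}" for v
      using assms(1)[OF that] that by (auto simp: p_def q_def algebra_simps power_numeral_reduce)
  qed (use assms(2) in \<open>auto simp: p_def q_def numeral_eq_Suc\<close>)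
  then have "poly p v = poly q v" by simp
  then show ?thesis by (simp add: p_def q_def algebra_simps power_numeral_reduce)
qed

lemma G3_factor_if_distinct_roots:
  assumes "G3 w t = 0" "G3 x t = 0" "G3 y t = 0" "G3 z t = 0" and "card {w, x, y, z} = 4"
  shows "G3 v t = (v - w) * (v - x) * (v - y) * (v - z)"
proof -
  have expand: "G3 v t = v ^ 4 + (12 * t - 16 * t * (4 * t - 3)\<^sup>2) * v ^ 3
      + (38 * t\<^sup>2 - 32 * t * (4 * t - 3) * (4 - 3 * t)) * v\<^sup>2
      + (12 * t ^ 3 - 16 * t * (4 - 3 * t)\<^sup>2) * v + t ^ 4" for v
    unfolding G3_def by algebra
  show ?thesis
    using assms unfolding expand by (intro monic_quartic_factor) auto
qed

lemma one_plus_sq_inj: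
  fixes x y :: "'a :: real_normed_field"
  assumes "(1 + x)\<^sup>2 = (1 + y)\<^sup>2" "norm x < 1" "norm y < 1"
  shows "x = y"
proof (rule ccontr)
  assume "x \<noteq> y"
  moreover have "(x - y) * (x + y + 2) = 0" using assms(1) by algebra
  ultimately have "x + y = -2" by (simp add: add_eq_0_iff2)
  then have "2 = norm (x + y)" by simp
  with norm_triangle_ineq[of x y] assms(2,3) show False by linarith
qed

lemma cubic_lift_rotations_neq:
  assumes c_small: "c \<noteq> 0" "cmod c < 1 / 25"
    and a_root: "a ^ 3 = 1" "cmod a = 1" and b_root: "b ^ 3 = 1" "cmod b = 1" and "a \<noteq> b"
  shows "cubic_mod (cubic_lift (a * c)) \<noteq> cubic_mod (cubic_lift (b * c))"
proof
  assume equal: "cubic_mod (cubic_lift (a * c)) = cubic_mod (cubic_lift (b * c))"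
  have "hypergeo_half (cubic_comod (cubic_param c)) \<noteq> 0"
    using c_small(2) by (intro hypergeo_half_nonzero norm_cubic_less_1 norm_cubic_param_lift_less)
  moreover have "hypergeo_half (cubic_mod (cubic_lift (x * c))) =
      (1 + x * c)\<^sup>2 * hypergeo_half (cubic_comod (cubic_param c))" if "x ^ 3 = 1" "cmod x = 1" for x
    using hypergeo_half_cubic_lift[of "x * c"] that c_small(2) by (simp add: norm_mult cubic_param_rotate)
  ultimately have "(1 + a * c)\<^sup>2 = (1 + b * c)\<^sup>2"
    using equal a_root b_root by (metis mult_right_cancel)
  moreover have "cmod (a * c) < 1" "cmod (b * c) < 1"
    using a_root(2) b_root(2) c_small(2) by (simp_all add: norm_mult)
  ultimately have "a * c = b * c" by (rule one_plus_sq_inj)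
  then show False using \<open>a \<noteq> b\<close> c_small(1) by simp
qed

lemma cubic_comod_neq_cubic_lift:
  assumes "c \<noteq> 0" "cmod c < 1 / 25"
  shows "cubic_comod (cubic_param c) \<noteq> cubic_mod (cubic_lift c)"
proof
  assume "cubic_comod (cubic_param c) = cubic_mod (cubic_lift c)"
  moreover have "hypergeo_half (cubic_comod (cubic_param c)) \<noteq> 0"
    using assms(2) by (intro hypergeo_half_nonzero norm_cubic_less_1 norm_cubic_param_lift_less)
  ultimately have "(1 + c)\<^sup>2 = (1 + 0)\<^sup>2"
    using hypergeo_half_cubic_lift[OF assms(2)] by (metis add_0_right mult_cancel_right1 one_power2)
  then have "c = 0" by (rule one_plus_sq_inj) (use assms(2) in simp_all)
  then show False using assms(1) by simp
qed

lemma cubic_roots_distinct: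
  assumes omega: "\<omega>\<^sup>2 + \<omega> + 1 = 0" and c_small: "c \<noteq> 0" "cmod c < 1 / 25"
  shows "card {cubic_comod (cubic_param c), cubic_mod (cubic_lift c), cubic_mod (cubic_lift (\<omega> * c)),
    cubic_mod (cubic_lift (\<omega>\<^sup>2 * c))} = 4"
proof -
  define v where "v = cubic_comod (cubic_param c)"
  define u where "u = (\<lambda>a. cubic_mod (cubic_lift (a * c)))"
  note root = cube_root_of_unity[OF omega]
  have "v \<noteq> u a" if "a ^ 3 = 1" "cmod a = 1" for a
  proof -
    have "a * c \<noteq> 0" "cmod (a * c) < 1 / 25" using that(2) c_small by (auto simp: norm_mult)
    from cubic_comod_neq_cubic_lift[OF this] show ?thesis
      by (simp add: v_def u_def cubic_param_rotate[OF that(1)])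
  qed
  from this[OF _ norm_one] this[OF root(1,3)] this[OF root(2,4)]
  have "v \<noteq> u 1" "v \<noteq> u \<omega>" "v \<noteq> u (\<omega>\<^sup>2)" by simp_all
  moreover have "u 1 \<noteq> u \<omega>" "u 1 \<noteq> u (\<omega>\<^sup>2)" "u \<omega> \<noteq> u (\<omega>\<^sup>2)"
    unfolding u_def using root by (intro cubic_lift_rotations_neq[OF c_small]; simp)+
  ultimately have "card {v, u 1, u \<omega>, u (\<omega>\<^sup>2)} = 4"
    by simp
  then show ?thesis by (simp add: v_def u_def)
qed

lemma G3_factor_cubic:
  assumes omega: "\<omega>\<^sup>2 + \<omega> + 1 = 0" and c_small: "c \<noteq> 0" "cmod c < 1 / 25"
  defines "p \<equiv> cubic_param c"
  shows "G3 z (cubic_mod p) = (z - cubic_comod p) * (z - cubic_mod (cubic_lift c)) *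
    (z - cubic_mod (cubic_lift (\<omega> * c))) * (z - cubic_mod (cubic_lift (\<omega>\<^sup>2 * c)))"
proof (rule G3_factor_if_distinct_roots)
  note root = cube_root_of_unity[OF omega]
  show "G3 (cubic_comod p) (cubic_mod p) = 0"
    using cubic_factors_nonzero(1)[OF norm_cubic_param_lift_less(1)[OF c_small(2)]]
    by (subst G3_commute) (simp add: p_def G3_cubic)
  have lift_root: "G3 (cubic_mod (cubic_lift (a * c))) (cubic_mod p) = 0"
    if "a ^ 3 = 1" "cmod a = 1" for a
  proof -
    have ac_small: "cmod (a * c) < 1 / 25" using that c_small(2) by (simp add: norm_mult)
    then have "cubic_comod (cubic_lift (a * c)) = cubic_mod p"
      using cubic_comod_lift[OF one_plus_power3_nonzero, of "a * c"]
      by (simp add: cubic_param_rotate[OF that(1)] p_def)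
    then show ?thesis
      using G3_cubic[OF cubic_factors_nonzero(1)[OF norm_cubic_param_lift_less(2)[OF ac_small]]] by simp
  qed
  show "G3 (cubic_mod (cubic_lift c)) (cubic_mod p) = 0" using lift_root[of 1] by simp
  show "G3 (cubic_mod (cubic_lift (\<omega> * c))) (cubic_mod p) = 0"
    by (rule lift_root[OF root(1,3)])
  show "G3 (cubic_mod (cubic_lift (\<omega>\<^sup>2 * c))) (cubic_mod p) = 0"
    by (rule lift_root[OF root(2,4)])
  show "card {cubic_comod p, cubic_mod (cubic_lift c), cubic_mod (cubic_lift (\<omega> * c)),
      cubic_mod (cubic_lift (\<omega>\<^sup>2 * c))} = 4"
    unfolding p_def by (rule cubic_roots_distinct[OF omega c_small])
qed

lemma cubic_param_surj:
  assumes "p \<noteq> 0" "cmod p < 1 / 125000"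
  obtains c where "c \<noteq> 0" "cmod c < 1 / 25" "cubic_param c = p"
proof
  define z where "z = 4 * p * (1 + p)"
  define c where "c = exp (Ln z / 3)"
  have "z \<noteq> 0" using cubic_factors_nonzero(3)[of p] assms by (simp add: z_def)
  then have c_cube: "c ^ 3 = z"
    unfolding c_def by (subst exp_of_nat_mult[symmetric]) simp
  show "c \<noteq> 0" by (simp add: c_def)
  have "cmod c ^ 3 = 4 * cmod p * cmod (1 + p)"
    unfolding norm_power[symmetric] c_cube by (simp add: z_def norm_mult)
  also have "\<dots> \<le> 4 * cmod p * 2"
    using norm_triangle_ineq[of 1 p] assms(2) by (intro mult_left_mono) auto
  also have "\<dots> < (1 / 25) ^ 3" using assms(2) by (simp add: power3_eq_cube)
  finally show "cmod c < 1 / 25" by (rule power_less_imp_less_base) simp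
  have "1 + c ^ 3 = (1 + 2 * p)\<^sup>2" unfolding c_cube z_def by algebra
  moreover have "0 < Re (1 + 2 * p)" using abs_Re_le_cmod[of p] assms(2) by simp
  ultimately show "cubic_param c = p"
    by (simp add: cubic_param_def csqrt_square)
qed

subsection \<open>The Mahler measure of G3\<close>

lemma mahler2_G3_cubic:
  assumes p_small: "p \<noteq> 0" "cmod p < 1 / 125000"
  defines "t \<equiv> cubic_mod p" and "v \<equiv> cubic_comod p"
  shows "mahler2 (\<lambda>x y. G3 ((x + inverse x)\<^sup>2 * (y + inverse y)\<^sup>2 / 16) (inverse t)) =
    4 * Re (log_mean v) - 8 * Re (log_mean t) + 32 * Re (Ln (1 + p / 2)) - 32 * Re (Ln (1 + 2 * p))
      - 4 * ln (cmod t)"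
proof -
  obtain c where c_props: "c \<noteq> 0" "cmod c < 1 / 25" "cubic_param c = p"
    using cubic_param_surj[OF p_small] by blast
  define \<omega> where "\<omega> = Complex (- 1 / 2) (sqrt 3 / 2)"
  have omega: "\<omega>\<^sup>2 + \<omega> + 1 = 0"
    by (simp add: \<omega>_def complex_eq_iff power2_eq_square)
  have rotate: "cmod (cubic_mod (cubic_lift (a * c))) < 1" if "cmod a = 1" for a
    using that c_props(2) by (intro norm_cubic_less_1 norm_cubic_param_lift_less) (simp add: norm_mult)
  have p_less: "cmod p < 1 / 20" using p_small by simp
  have "t \<noteq> 0" using p_small(1) cubic_factors_nonzero[OF p_less] by (simp add: t_def cubic_mod_def)
  then have "mahler2 (\<lambda>x y. G3 ((x + inverse x)\<^sup>2 * (y + inverse y)\<^sup>2 / 16) (inverse t)) =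
      Re (log_mean v + log_mean (cubic_mod (cubic_lift c)) + log_mean (cubic_mod (cubic_lift (\<omega> * c)))
        + log_mean (cubic_mod (cubic_lift (\<omega>\<^sup>2 * c)))) - 4 * ln (cmod t)"
    using G3_factor_cubic[OF omega c_props(1,2)] rotate[of 1] rotate[of \<omega>] rotate[of "\<omega>\<^sup>2"]
      cube_root_of_unity(3,4)[OF omega] norm_cubic_less_1(2)[OF p_less] c_props(3)
    unfolding v_def by (intro mahler2_G3) (simp_all add: t_def)
  also have "log_mean v + log_mean (cubic_mod (cubic_lift c)) + log_mean (cubic_mod (cubic_lift (\<omega> * c)))
        + log_mean (cubic_mod (cubic_lift (\<omega>\<^sup>2 * c))) =
      4 * log_mean v - 8 * log_mean t + 32 * Ln (1 + p / 2) - 32 * Ln (1 + 2 * p)"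
    using log_mean_hecke[OF omega c_props(2)] by (simp add: c_props(3) t_def v_def algebra_simps)
  finally show ?thesis by simp
qed

lemma ln_cmod_cubic:
  assumes "p \<noteq> 0" "cmod p < 1 / 20"
  shows "ln (cmod (cubic_mod p)) = ln (cmod p) + 3 * ln (cmod (2 + p)) - 3 * ln (cmod (1 + 2 * p))"
    and "ln (cmod (cubic_comod p)) = 3 * ln (cmod p) + ln (cmod (2 + p)) - ln (cmod (1 + 2 * p))"
    and "Re (Ln (1 + p / 2)) = ln (cmod (2 + p)) - ln 2"
    and "Re (Ln (1 + 2 * p)) = ln (cmod (1 + 2 * p))"
proof -
  note nonzero = cubic_factors_nonzero[OF assms(2)]
  show "ln (cmod (cubic_mod p)) = ln (cmod p) + 3 * ln (cmod (2 + p)) - 3 * ln (cmod (1 + 2 * p))"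
    "ln (cmod (cubic_comod p)) = 3 * ln (cmod p) + ln (cmod (2 + p)) - ln (cmod (1 + 2 * p))"
    using assms(1) nonzero
    by (simp_all add: cubic_mod_def cubic_comod_def norm_divide norm_mult norm_power
        ln_div ln_mult ln_realpow)
  have half: "1 + p / 2 = (2 + p) / 2" by (simp add: field_simps)
  show "Re (Ln (1 + p / 2)) = ln (cmod (2 + p)) - ln 2"
    unfolding half using nonzero by (subst Re_Ln) (auto simp: norm_divide ln_div)
  show "Re (Ln (1 + 2 * p)) = ln (cmod (1 + 2 * p))"
    using nonzero by (simp add: Re_Ln)
qed

theorem mainTheorem11:
  shows "\<exists>\<epsilon>>0. \<forall>p::complex. 0 < cmod p \<and> cmod p < \<epsilon> \<longrightarrow>
    mahler2 (\<lambda>x y. G3 ((x + inverse x)^2 * (y + inverse y)^2 / 16)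
                       ((1 / p) * ((1 + 2*p) / (2 + p))^3))
    = - 16 * ln 2 - 16 * mu (p * ((2 + p) / (1 + 2*p))^3)
      + 8 * mu (p^3 * ((2 + p) / (1 + 2*p)))"
proof (intro exI[of _ "1 / 125000"] conjI allI impI)
  fix p :: complex
  assume "0 < cmod p \<and> cmod p < 1 / 125000"
  then have p_small: "p \<noteq> 0" "cmod p < 1 / 125000" "cmod p < 1 / 20" by auto
  have "p * ((2 + p) / (1 + 2 * p)) ^ 3 = cubic_mod p" "p ^ 3 * ((2 + p) / (1 + 2 * p)) = cubic_comod p"
    and "1 / p * ((1 + 2 * p) / (2 + p)) ^ 3 = inverse (cubic_mod p)"
    by (simp_all add: cubic_mod_def cubic_comod_def power_divide)
  moreover have "cubic_mod p \<noteq> 0" "cubic_comod p \<noteq> 0"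
    using p_small(1) cubic_factors_nonzero[OF p_small(3)] by (simp_all add: cubic_mod_def cubic_comod_def)
  moreover have "ln 4 = 2 * ln (2 :: real)"
    using ln_realpow[of 2 2] by simp
  ultimately show "mahler2 (\<lambda>x y. G3 ((x + inverse x)^2 * (y + inverse y)^2 / 16)
                       ((1 / p) * ((1 + 2*p) / (2 + p))^3))
    = - 16 * ln 2 - 16 * mu (p * ((2 + p) / (1 + 2*p))^3)
      + 8 * mu (p^3 * ((2 + p) / (1 + 2*p)))"
    using norm_cubic_less_1[OF p_small(3)]
    by (simp add: mahler2_G3_cubic[OF p_small(1,2)] mu_eq_log_mean ln_cmod_cubic[OF p_small(1,3)])
      (simp add: field_simps)
qed simp

end
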